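(* (a) Consider the edge-based protocol on an arbitrary graph $G$ with $n$ nodes and maximum degree $\Delta$, where $\gamma > 1$ is any constant. Then for any round $t$, $\Pr\left[ \max_{w \in V} | x_w^{(t)} - \xi_w^{(t)} | = \mathcal{O}( \sqrt{ \Delta \log n } ) \right] \geq 1 - 2n^{-1}$; and after $\mathcal{O}\left(\frac{\log (Kn)}{1-\lambda(\mathbf{P})}\right)$ rounds the discrepancy is at most $\mathcal{O}( \sqrt{\Delta \log n})$ with probability at least $1-n^{-1}$. (b) Consider the vertex-based protocol on a $d$-regular graph $G$. Then for any round $t$, $\Pr\left[ \max_{w \in V} | x_w^{(t)} - \xi_w^{(t)} | = \mathcal{O}( d^2 \sqrt{\log n} )\right] \geq 1 - 2n^{-1}$; and after $\mathcal{O}\left(\frac{\log (Kn)}{1-\lambda(\mathbf{P})}\right)$ rounds the discrepancy is at most $\mathcal{O}( d^{2} \sqrt{\log n})$ with probability at least $1-n^{-1}$.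
   Context: $G=(V,E)$ is connected, $K$ is the discrepancy $\max_{u,v}|x^{(0)}_u-x^{(0)}_v|$ of the initial integer load vector. Diffusion matrix $\mathbf{P}=\mathbf{P}(\gamma)$: $\mathbf{P}_{u,v}=\frac{1}{\gamma\Delta}$ for $\{u,v\}\in E$, $\mathbf{P}_{u,u}=1-\frac{\deg(u)}{\gamma\Delta}$, $0$ otherwise; $\lambda(\mathbf{P})=\max\{|\lambda_2(\mathbf{P})|,|\lambda_n(\mathbf{P})|\}$. The continuous process is $\xi^{(t)}=\xi^{(t-1)}\mathbf{P}$ with $\xi^{(0)}=x^{(0)}$. Edge-based protocol: in each round, for every edge $\{u,v\}$, the amount of load the continuous diffusion would send along the edge given the current discrete loads, $y=(x^{(t-1)}_u-x^{(t-1)}_v)/(\gamma\Delta)$, is randomly rounded to $\lceil y\rceil$ with probability $y-\lfloor y\rfloor$ and to $\lfloor y\rfloor$ otherwise (so the rounding error has mean $0$), independently over edges, and that integer number of tokens is sent from $u$ to $v$. Vertex-based protocol (with $\gamma=1+1/d$, i.e. $\Delta=d$): in each round every node $u$ sends $\lfloor x^{(t-1)}_u/(d+1)\rfloor$ tokens to each neighbor and keeps the same amount, and the remaining $x^{(t-1)}_u-(d+1)\lfloor x^{(t-1)}_u/(d+1)\rfloor$ tokens are distributed uniformly at random without replacement among $u$ and its $d$ neighbors (at most one per node). *)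

theory Defs
  imports "HOL-Probability.Probability" "Jordan_Normal_Form.Char_Poly"
    "HOL-Computational_Algebra.Polynomial"
begin

definition graph_on :: "nat \<Rightarrow> (nat \<Rightarrow> nat \<Rightarrow> bool) \<Rightarrow> bool" where
  "graph_on n E \<longleftrightarrow> n \<ge> 1 \<and> (\<forall>u v. E u v \<longrightarrow> u < n \<and> v < n \<and> u \<noteq> v \<and> E v u)"

definition connected_on :: "nat \<Rightarrow> (nat \<Rightarrow> nat \<Rightarrow> bool) \<Rightarrow> bool" where
  "connected_on n E \<longleftrightarrow> (\<forall>u<n. \<forall>v<n. E\<^sup>*\<^sup>* u v)"

definition deg :: "nat \<Rightarrow> (nat \<Rightarrow> nat \<Rightarrow> bool) \<Rightarrow> nat \<Rightarrow> nat" where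
  "deg n E u = card {v. v < n \<and> E u v}"

definition maxdeg :: "nat \<Rightarrow> (nat \<Rightarrow> nat \<Rightarrow> bool) \<Rightarrow> nat" where
  "maxdeg n E = Max (deg n E ` {..<n})"

definition regular_on :: "nat \<Rightarrow> (nat \<Rightarrow> nat \<Rightarrow> bool) \<Rightarrow> nat \<Rightarrow> bool" where
  "regular_on n E d \<longleftrightarrow> (\<forall>u<n. deg n E u = d)"

definition Pent :: "real \<Rightarrow> nat \<Rightarrow> (nat \<Rightarrow> nat \<Rightarrow> bool) \<Rightarrow> nat \<Rightarrow> nat \<Rightarrow> real" where
  "Pent \<gamma> n E u v =
     (if u = v then 1 - real (deg n E u) / (\<gamma> * real (maxdeg n E))
      else if E u v then 1 / (\<gamma> * real (maxdeg n E)) else 0)"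

definition Pmat :: "real \<Rightarrow> nat \<Rightarrow> (nat \<Rightarrow> nat \<Rightarrow> bool) \<Rightarrow> real mat" where
  "Pmat \<gamma> n E = mat n n (\<lambda>(u, v). Pent \<gamma> n E u v)"

definition eigs_sorted :: "real mat \<Rightarrow> real list" where
  "eigs_sorted A = sorted_list_of_multiset (proots (char_poly A))"

definition lambda2 :: "real mat \<Rightarrow> real" where
  "lambda2 A = rev (eigs_sorted A) ! 1"

definition lambdan :: "real mat \<Rightarrow> real" where
  "lambdan A = eigs_sorted A ! 0"

definition lam :: "real mat \<Rightarrow> real" where
  "lam A = max \<bar>lambda2 A\<bar> \<bar>lambdan A\<bar>"

primrec xi :: "real \<Rightarrow> nat \<Rightarrow> (nat \<Rightarrow> nat \<Rightarrow> bool) \<Rightarrow> (nat \<Rightarrow> int) \<Rightarrow> nat \<Rightarrow> nat \<Rightarrow> real" where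
  "xi \<gamma> n E x0 0 = (\<lambda>w. real_of_int (x0 w))"
| "xi \<gamma> n E x0 (Suc t) = (\<lambda>w. \<Sum>u<n. xi \<gamma> n E x0 t u * Pent \<gamma> n E u w)"

definition discK :: "nat \<Rightarrow> (nat \<Rightarrow> int) \<Rightarrow> int" where
  "discK n x0 = Max {\<bar>x0 u - x0 v\<bar> | u v. u < n \<and> v < n}"

definition rround :: "real \<Rightarrow> int pmf" where
  "rround y = map_pmf (\<lambda>b. if b then \<lceil>y\<rceil> else \<lfloor>y\<rfloor>) (bernoulli_pmf (y - of_int \<lfloor>y\<rfloor>))"

text \<open>Edge-based protocol: each edge {u,v} (u<v) independently; the rounded amount f(u,v)
  is sent from u to v (a negative amount means tokens move from v to u).\<close>

definition edges_ord :: "nat \<Rightarrow> (nat \<Rightarrow> nat \<Rightarrow> bool) \<Rightarrow> (nat \<times> nat) set" where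
  "edges_ord n E = {(u, v). u < n \<and> v < n \<and> E u v \<and> u < v}"

definition edge_step :: "real \<Rightarrow> nat \<Rightarrow> (nat \<Rightarrow> nat \<Rightarrow> bool) \<Rightarrow> (nat \<Rightarrow> int) \<Rightarrow> (nat \<Rightarrow> int) pmf" where
  "edge_step \<gamma> n E x =
     map_pmf (\<lambda>f w. x w - (\<Sum>v\<in>{v. (w, v) \<in> edges_ord n E}. f (w, v))
                        + (\<Sum>u\<in>{u. (u, w) \<in> edges_ord n E}. f (u, w)))
       (Pi_pmf (edges_ord n E) 0
          (\<lambda>(u, v). rround (real_of_int (x u - x v) / (\<gamma> * real (maxdeg n E)))))"

primrec edge_proc :: "real \<Rightarrow> nat \<Rightarrow> (nat \<Rightarrow> nat \<Rightarrow> bool) \<Rightarrow> (nat \<Rightarrow> int) \<Rightarrow> nat \<Rightarrow> (nat \<Rightarrow> int) pmf" where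
  "edge_proc \<gamma> n E x0 0 = return_pmf x0"
| "edge_proc \<gamma> n E x0 (Suc t) = bind_pmf (edge_proc \<gamma> n E x0 t) (edge_step \<gamma> n E)"

text \<open>Vertex-based protocol (d-regular graph, gamma = 1 + 1/d): node u sends
  floor(x_u/(d+1)) to each neighbour and keeps as much; the remaining x_u mod (d+1) tokens go
  to a uniformly random subset of that size of the closed neighbourhood of u.\<close>

definition cnbhd :: "nat \<Rightarrow> (nat \<Rightarrow> nat \<Rightarrow> bool) \<Rightarrow> nat \<Rightarrow> nat set" where
  "cnbhd n E u = {v. v < n \<and> (v = u \<or> E u v)}"

definition vertex_step :: "nat \<Rightarrow> (nat \<Rightarrow> nat \<Rightarrow> bool) \<Rightarrow> nat \<Rightarrow> (nat \<Rightarrow> int) \<Rightarrow> (nat \<Rightarrow> int) pmf" where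
  "vertex_step n E d x =
     map_pmf (\<lambda>S w. (\<Sum>u\<in>{u. u < n \<and> w \<in> cnbhd n E u}. x u div int (d + 1))
                     + int (card {u. u < n \<and> w \<in> S u}))
       (Pi_pmf {..<n} {}
          (\<lambda>u. pmf_of_set {S. S \<subseteq> cnbhd n E u \<and> card S = nat (x u mod int (d + 1))}))"

primrec vertex_proc :: "nat \<Rightarrow> (nat \<Rightarrow> nat \<Rightarrow> bool) \<Rightarrow> nat \<Rightarrow> (nat \<Rightarrow> int) \<Rightarrow> nat \<Rightarrow> (nat \<Rightarrow> int) pmf" where
  "vertex_proc n E d x0 0 = return_pmf x0"
| "vertex_proc n E d x0 (Suc t) = bind_pmf (vertex_proc n E d x0 t) (vertex_step n E d)"

end

theory Submission
  imports Defs "Jordan_Normal_Form.Schur_Decomposition"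
begin

text \<open>
  Let \<open>P\<close> be the diffusion matrix. In both protocols, one round maps the load vector \<open>x\<close> to
  \<open>P x\<close> plus a sum of independent, bounded, centred errors, so Hoeffding's lemma gives
  \<open>E exp \<langle>a, x'\<rangle> \<le> exp (\<langle>P a, x\<rangle> + c D(a))\<close>, where \<open>D\<close> is the Dirichlet form of the graph
  (\<open>c = 1/16\<close> for edges and \<open>c = d/8\<close> for vertices, every edge being counted twice in \<open>D\<close>).
  Iterating over \<open>t\<close> rounds yields \<open>E exp \<langle>a, x\<^sub>t\<rangle> \<le> exp (\<langle>a, \<xi>\<^sub>t\<rangle> + c (\<Sum>s<t. D(P\<^sup>s a)))\<close>, and the last sum
  is bounded independently of \<open>t\<close> because \<open>|f|\<^sup>2 - |P f|\<^sup>2\<close> dominates a multiple of \<open>D(f)\<close>. Taking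
  \<open>a\<close> to be a multiple of a unit vector, Chernoff's bound and a union bound give the deviation bounds.
  For the discrepancy, the spectral decomposition of the symmetric matrix \<open>P\<close> shows that the centred
  part of \<open>\<xi>\<^sub>t\<close> shrinks like \<open>\<lambda>\<^sup>t\<close>, hence is at most \<open>1\<close> after \<open>ln (K n) / (1 - \<lambda>)\<close> rounds.
\<close>

section \<open>The diffusion operator and its Dirichlet form\<close>

definition nbrs :: "nat \<Rightarrow> (nat \<Rightarrow> nat \<Rightarrow> bool) \<Rightarrow> nat \<Rightarrow> nat set" where
  "nbrs n E u = {v. v < n \<and> E u v}"

definition ip :: "nat \<Rightarrow> (nat \<Rightarrow> real) \<Rightarrow> (nat \<Rightarrow> real) \<Rightarrow> real" where
  "ip n f g = (\<Sum>u<n. f u * g u)"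

lemma ip_commute: "ip n f g = ip n g f"
  by (simp add: ip_def mult.commute)

lemma ip_add_right: "ip n h (\<lambda>u. f u + g u) = ip n h f + ip n h g"
  by (simp add: ip_def algebra_simps sum.distrib)

lemma ip_diff_left: "ip n (\<lambda>u. f u - g u) h = ip n f h - ip n g h"
  by (simp add: ip_def algebra_simps sum_subtractf)

lemma ip_diff_right: "ip n h (\<lambda>u. f u - g u) = ip n h f - ip n h g"
  by (simp add: ip_def algebra_simps sum_subtractf)

lemma ip_scale_left: "ip n (\<lambda>u. c * f u) h = c * ip n f h"
  by (simp add: ip_def sum_distrib_left algebra_simps)

lemma ip_scale_right: "ip n h (\<lambda>u. c * f u) = c * ip n h f"
  by (simp add: ip_def sum_distrib_left algebra_simps)

lemma ip_sum_left: "ip n (\<lambda>u. \<Sum>i\<in>S. f i u) h = (\<Sum>i\<in>S. ip n (f i) h)"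
  unfolding ip_def by (subst sum.swap) (simp add: sum_distrib_right)

lemma ip_sum_right: "ip n h (\<lambda>u. \<Sum>i\<in>S. f i u) = (\<Sum>i\<in>S. ip n h (f i))"
  using ip_sum_left[of n f S h] by (simp add: ip_commute)

lemma ip_cong:
  "\<lbrakk>\<And>u. u < n \<Longrightarrow> f u = f' u; \<And>u. u < n \<Longrightarrow> g u = g' u\<rbrakk> \<Longrightarrow> ip n f g = ip n f' g'"
  by (simp add: ip_def)

lemma ip_self_nonneg: "0 \<le> ip n f f"
  by (simp add: ip_def sum_nonneg)

lemma ip_self_eq_0_iff: "ip n f f = 0 \<longleftrightarrow> (\<forall>u<n. f u = 0)"
  unfolding ip_def by (subst sum_nonneg_eq_0_iff) auto

lemma square_le_ip_self: "w < n \<Longrightarrow> (f w)\<^sup>2 \<le> ip n f f"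
  using member_le_sum[of w "{..<n}" "\<lambda>u. f u * f u"] by (simp add: ip_def power2_eq_square)

text \<open>Both orientations of each edge occur in the sum, which explains the halves in the
  identities below.\<close>

definition Dir :: "nat \<Rightarrow> (nat \<Rightarrow> nat \<Rightarrow> bool) \<Rightarrow> (nat \<Rightarrow> real) \<Rightarrow> real" where
  "Dir n E f = (\<Sum>u<n. \<Sum>v\<in>nbrs n E u. (f u - f v)\<^sup>2)"

lemma Dir_nonneg: "0 \<le> Dir n E f"
  by (simp add: Dir_def sum_nonneg)

section \<open>The diffusion operator and its energy estimates\<close>

definition Pop :: "real \<Rightarrow> nat \<Rightarrow> (nat \<Rightarrow> nat \<Rightarrow> bool) \<Rightarrow> (nat \<Rightarrow> real) \<Rightarrow> nat \<Rightarrow> real" where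
  "Pop \<gamma> n E f u = (\<Sum>v<n. Pent \<gamma> n E u v * f v)"

lemma Pop_add: "Pop \<gamma> n E (\<lambda>u. f u + g u) = (\<lambda>u. Pop \<gamma> n E f u + Pop \<gamma> n E g u)"
  by (auto simp: Pop_def algebra_simps sum.distrib)

lemma Pop_diff: "Pop \<gamma> n E (\<lambda>u. f u - g u) = (\<lambda>u. Pop \<gamma> n E f u - Pop \<gamma> n E g u)"
  by (auto simp: Pop_def algebra_simps sum_subtractf)

lemma Pop_scale: "Pop \<gamma> n E (\<lambda>u. c * f u) = (\<lambda>u. c * Pop \<gamma> n E f u)"
  by (auto simp: Pop_def algebra_simps sum_distrib_left)

lemma Pop_sum: "Pop \<gamma> n E (\<lambda>u. \<Sum>i\<in>S. f i u) = (\<lambda>u. \<Sum>i\<in>S. Pop \<gamma> n E (f i) u)"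
  unfolding Pop_def by (auto simp: sum_distrib_left sum.swap[of _ S])

lemma Pop_cong: "(\<And>v. v < n \<Longrightarrow> f v = g v) \<Longrightarrow> Pop \<gamma> n E f = Pop \<gamma> n E g"
  by (auto simp: Pop_def)

text \<open>The bound on the maximum degree makes \<open>1 / (\<gamma> * real (maxdeg n E))\<close>
  a genuine quotient, and \<gamma> > 1 leaves every vertex a positive holding weight. Connectedness
  enters later, as an explicit assumption of the spectral statements.\<close>

locale diffusion =
  fixes \<gamma> :: real and n :: nat and E :: "nat \<Rightarrow> nat \<Rightarrow> bool"
  assumes graph: "graph_on n E" and gamma_gt_1: "\<gamma> > 1" and maxdeg_pos: "maxdeg n E \<ge> 1"
begin

abbreviation P where "P \<equiv> Pop \<gamma> n E"
abbreviation inner where "inner \<equiv> ip n"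
abbreviation N where "N \<equiv> nbrs n E"

definition \<kappa> where "\<kappa> = 1 / (\<gamma> * real (maxdeg n E))"

lemma E_sym: "E u v \<longleftrightarrow> E v u" and E_irrefl: "\<not> E u u" and E_less: "E u v \<Longrightarrow> u < n \<and> v < n"
  using graph by (auto simp: graph_on_def)

lemma n_pos: "n \<ge> 1"
  using graph by (simp add: graph_on_def)

lemma finite_N [simp]: "finite (N u)"
  by (simp add: nbrs_def)

lemma card_N: "card (N u) = deg n E u"
  by (simp add: nbrs_def deg_def)

lemma deg_le: "u < n \<Longrightarrow> deg n E u \<le> maxdeg n E"
  by (simp add: maxdeg_def)

lemma kappa_pos: "\<kappa> > 0"
  using gamma_gt_1 maxdeg_pos by (simp add: \<kappa>_def)

lemma kappa_deg_le: "u < n \<Longrightarrow> \<kappa> * real (deg n E u) \<le> 1 / \<gamma>"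
  using gamma_gt_1 maxdeg_pos deg_le[of u] by (simp add: \<kappa>_def field_simps)

lemma Pent_sym: "Pent \<gamma> n E u v = Pent \<gamma> n E v u"
  using E_sym[of u v] by (simp add: Pent_def)

text \<open>Rows of the matrix sum to 1, so \<open>P\<close> is the identity minus
  \<open>\<kappa>\<close> times the graph Laplacian. The energy estimates start from this
  form.\<close>

lemma Pop_eq: "u < n \<Longrightarrow> P f u = f u - \<kappa> * (\<Sum>v\<in>N u. f u - f v)"
proof -
  assume u: "u < n"
  have uN: "u \<notin> N u" and sub: "N u \<subseteq> {..<n} - {u}"
    using E_irrefl by (auto simp: nbrs_def)
  have "P f u = Pent \<gamma> n E u u * f u + (\<Sum>v\<in>{..<n} - {u}. Pent \<gamma> n E u v * f v)"
    unfolding Pop_def using u by (subst sum.remove[of _ u]) auto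
  also have "(\<Sum>v\<in>{..<n} - {u}. Pent \<gamma> n E u v * f v) = (\<Sum>v\<in>N u. \<kappa> * f v)"
    using sub by (intro sum.mono_neutral_cong_right) (auto simp: Pent_def nbrs_def \<kappa>_def)
  also have "Pent \<gamma> n E u u * f u = f u - \<kappa> * (\<Sum>v\<in>N u. f u)"
    by (simp add: Pent_def card_N \<kappa>_def algebra_simps)
  finally show ?thesis
    by (simp add: sum_subtractf sum_distrib_left algebra_simps)
qed

lemma sum_nbrs_swap: "(\<Sum>u<n. \<Sum>v\<in>N u. g u v) = (\<Sum>u<n. \<Sum>v\<in>N u. g v u)"
proof -
  have "(\<Sum>u<n. \<Sum>v\<in>N u. g u v) = (\<Sum>v<n. \<Sum>u\<in>{u. u < n \<and> v \<in> N u}. g u v)"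
    unfolding nbrs_def using sum.swap_restrict[of "{..<n}" "{..<n}" g "\<lambda>u v. E u v"] by simp
  moreover have "{u. u < n \<and> v \<in> N u} = N v" if "v < n" for v
    using that E_sym by (auto simp: nbrs_def)
  ultimately show ?thesis by simp
qed

lemma P_self_adjoint: "inner f (P g) = inner (P f) g"
proof -
  have "inner f (P g) = (\<Sum>u<n. \<Sum>v<n. f u * (Pent \<gamma> n E u v * g v))"
    by (simp add: ip_def Pop_def sum_distrib_left)
  also have "\<dots> = (\<Sum>v<n. \<Sum>u<n. f u * (Pent \<gamma> n E u v * g v))"
    by (rule sum.swap)
  also have "\<dots> = inner (P f) g"
    unfolding ip_def Pop_def sum_distrib_right by (intro sum.cong) (auto simp: Pent_sym mult_ac)
  finally show ?thesis .
qed

text \<open>The process multiplies row vectors by the matrix; symmetry of the matrix turns this into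
  iterating \<open>P\<close> on functions.\<close>

lemma xi_eq: "xi \<gamma> n E x0 t = (P ^^ t) (\<lambda>w. real_of_int (x0 w))"
proof (induction t)
  case (Suc t)
  then show ?case by (auto simp: Pop_def Pent_sym mult_ac)
qed simp

text \<open>Summation by parts: the Laplacian form is averaged with its copy in which the two
  endpoints of each edge are exchanged.\<close>

lemma inner_laplacian: "inner f g - inner f (P g) = \<kappa> / 2 * (\<Sum>u<n. \<Sum>v\<in>N u. (f u - f v) * (g u - g v))"
proof -
  have "inner f g - inner f (P g) = (\<Sum>u<n. f u * (\<kappa> * (\<Sum>v\<in>N u. g u - g v)))"
    by (simp add: ip_def Pop_eq sum_subtractf[symmetric] algebra_simps)
  also have "\<dots> = \<kappa> * (\<Sum>u<n. \<Sum>v\<in>N u. f u * (g u - g v))"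
    by (simp add: sum_distrib_left mult_ac)
  finally have 1: "inner f g - inner f (P g) = \<kappa> * (\<Sum>u<n. \<Sum>v\<in>N u. f u * (g u - g v))" .
  then have 2: "inner f g - inner f (P g) = \<kappa> * (\<Sum>u<n. \<Sum>v\<in>N u. f v * (g v - g u))"
    by (subst (asm) sum_nbrs_swap)
  have "2 * (inner f g - inner f (P g)) = 
      \<kappa> * (\<Sum>u<n. \<Sum>v\<in>N u. f u * (g u - g v)) + \<kappa> * (\<Sum>u<n. \<Sum>v\<in>N u. f v * (g v - g u))"
    unfolding mult_2 by (rule arg_cong2[where f = "(+)", OF 1 2])
  also have "\<dots> = \<kappa> * (\<Sum>u<n. \<Sum>v\<in>N u. f u * (g u - g v) + f v * (g v - g u))"
    by (simp only: distrib_left[symmetric] sum.distrib)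
  also have "\<dots> = \<kappa> * (\<Sum>u<n. \<Sum>v\<in>N u. (f u - f v) * (g u - g v))"
    by (simp add: algebra_simps)
  finally show ?thesis by simp
qed

lemma inner_laplacian_self: "inner f f - inner f (P f) = \<kappa> / 2 * Dir n E f"
  by (simp add: inner_laplacian Dir_def power2_eq_square)

text \<open>Cauchy-Schwarz at each vertex costs a factor deg(u), and one factor
  \<open>\<kappa>\<close> absorbs it because \<kappa> deg(u) \<le> 1/\<gamma>.\<close>

lemma norm_laplacian_le:
  "inner (\<lambda>u. f u - P f u) (\<lambda>u. f u - P f u) \<le> \<kappa> / \<gamma> * Dir n E f"
proof -
  have "inner (\<lambda>u. f u - P f u) (\<lambda>u. f u - P f u) = (\<Sum>u<n. \<kappa>\<^sup>2 * (\<Sum>v\<in>N u. f u - f v)\<^sup>2)"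
    by (simp add: ip_def Pop_eq power2_eq_square algebra_simps)
  also have "\<dots> \<le> (\<Sum>u<n. \<kappa> / \<gamma> * (\<Sum>v\<in>N u. (f u - f v)\<^sup>2))"
  proof (rule sum_mono)
    fix u assume "u \<in> {..<n}"
    then have u: "u < n" by simp
    have "(\<Sum>v\<in>N u. f u - f v)\<^sup>2 \<le> real (deg n E u) * (\<Sum>v\<in>N u. (f u - f v)\<^sup>2)" (is ?CS)
      using Cauchy_Schwarz_ineq_sum[of "\<lambda>v. 1" "\<lambda>v. f u - f v" "N u"] by (simp add: card_N)
    then have "\<kappa>\<^sup>2 * (\<Sum>v\<in>N u. f u - f v)\<^sup>2 \<le> \<kappa> * (\<kappa> * real (deg n E u)) * (\<Sum>v\<in>N u. (f u - f v)\<^sup>2)"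
      using mult_left_mono[OF \<open>?CS\<close>, of "\<kappa>\<^sup>2"] by (simp add: power2_eq_square[of \<kappa>] mult.assoc)
    also have "\<dots> \<le> \<kappa> * (1 / \<gamma>) * (\<Sum>v\<in>N u. (f u - f v)\<^sup>2)"
      using kappa_deg_le[OF u] kappa_pos by (intro mult_right_mono mult_left_mono sum_nonneg) auto
    finally show "\<kappa>\<^sup>2 * (\<Sum>v\<in>N u. f u - f v)\<^sup>2 \<le> \<kappa> / \<gamma> * (\<Sum>v\<in>N u. (f u - f v)\<^sup>2)" by simp
  qed
  also have "\<dots> = \<kappa> / \<gamma> * Dir n E f" by (simp add: Dir_def sum_distrib_left)
  finally show ?thesis .
qed

text \<open>Expand the square of P f = f - (f - P f): the cross term removes
  \<open>\<kappa> * Dir n E f\<close>, and the quadratic term gives back at most the fraction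
  1/\<gamma> of it.\<close>

lemma norm_P_le: "inner (P f) (P f) + \<kappa> * (1 - 1 / \<gamma>) * Dir n E f \<le> inner f f"
proof -
  have "inner (\<lambda>u. f u - P f u) (\<lambda>u. f u - P f u) =
      inner (P f) (P f) - inner f f + 2 * (inner f f - inner f (P f))"
    by (simp add: ip_diff_left ip_diff_right ip_commute[of n "P f" f])
  then show ?thesis
    using norm_laplacian_le[of f] inner_laplacian_self[of f] by (simp add: algebra_simps)
qed

text \<open>This bounds the squared local 2-divergence of the diffusion: the potential
  \<^term>\<open>inner f f\<close> loses a fixed multiple of the Dirichlet form in every round.\<close>

lemma sum_Dir_le: "\<kappa> * (1 - 1 / \<gamma>) * (\<Sum>s<t. Dir n E ((P ^^ s) f)) \<le> inner f f"
proof -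
  have "\<kappa> * (1 - 1 / \<gamma>) * (\<Sum>s<t. Dir n E ((P ^^ s) f)) + inner ((P ^^ t) f) ((P ^^ t) f) \<le> inner f f"
  proof (induction t)
    case (Suc t)
    then show ?case using norm_P_le[of "(P ^^ t) f"] by (simp add: distrib_left)
  qed simp
  then show ?thesis using ip_self_nonneg[of n "(P ^^ t) f"] by linarith
qed

end

section \<open>Spectral decomposition\<close>

context diffusion
begin

definition eigfun :: "real \<Rightarrow> (nat \<Rightarrow> real) \<Rightarrow> bool" where
  "eigfun \<nu> g \<longleftrightarrow> (\<forall>u<n. P g u = \<nu> * g u)"

lemma eigfun_inner: "eigfun \<nu> g \<Longrightarrow> inner f (P g) = \<nu> * inner f g"
  unfolding ip_scale_right[symmetric] by (rule ip_cong) (auto simp: eigfun_def)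

lemma eigfun_orthogonal:
  assumes "eigfun \<nu> g" "eigfun \<mu> h" "\<nu> \<noteq> \<mu>"
  shows "inner g h = 0"
proof -
  have "\<mu> * inner g h = inner g (P h)" by (rule eigfun_inner[OF assms(2), symmetric])
  also have "\<dots> = inner h (P g)" by (metis P_self_adjoint ip_commute)
  also have "\<dots> = \<nu> * inner g h" by (metis eigfun_inner[OF assms(1)] ip_commute)
  finally have "\<mu> * inner g h = \<nu> * inner g h" .
  then show ?thesis using assms(3) by simp
qed

lemma eigfun_linear:
  assumes "eigfun \<nu> g" "eigfun \<nu> h"
  shows "eigfun \<nu> (\<lambda>u. c * g u + d * h u)"
  using assms by (simp add: eigfun_def Pop_add Pop_scale algebra_simps)

lemma eigfun_pow:
  assumes "eigfun \<nu> g" "u < n"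
  shows "(P ^^ t) g u = \<nu> ^ t * g u"
  using assms(2)
proof (induction t arbitrary: u)
  case (Suc t)
  then have "P ((P ^^ t) g) u = P (\<lambda>v. \<nu> ^ t * g v) u"
    by (intro fun_cong[OF Pop_cong]) auto
  also have "\<dots> = \<nu> ^ Suc t * g u"
    using assms(1) Suc.prems by (simp add: Pop_scale eigfun_def)
  finally show ?case by simp
qed simp

lemma eigfun_const: "eigfun 1 (\<lambda>_. c)"
  by (simp add: eigfun_def Pop_eq)

lemma eigfun_Dir: "eigfun \<nu> g \<Longrightarrow> (1 - \<nu>) * inner g g = \<kappa> / 2 * Dir n E g"
  using inner_laplacian_self[of g] eigfun_inner[of \<nu> g g] by (simp add: algebra_simps)

lemma eigfun_le_1:
  assumes "eigfun \<nu> g" "inner g g \<noteq> 0"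
  shows "\<nu> \<le> 1"
proof -
  have "0 \<le> (1 - \<nu>) * inner g g"
    unfolding eigfun_Dir[OF assms(1)] using kappa_pos Dir_nonneg[of n E g] by simp
  then show ?thesis
    using assms(2) ip_self_nonneg[of n g] by (simp add: zero_le_mult_iff)
qed

text \<open>For an eigenfunction, \<open>norm_P_le\<close> reads \<nu>\<nu> + 2(1 - 1/\<gamma>)(1 -
  \<nu>) \<le> 1 after division by the squared norm. Dividing further by 1 - \<nu> gives 1 + \<nu>
  \<ge> 2(1 - 1/\<gamma>) > 0; the value \<nu> = 1 is therefore split off.\<close>

lemma eigfun_gt_neg_1:
  assumes "eigfun \<nu> g" "inner g g \<noteq> 0"
  shows "\<nu> > -1"
proof (cases "\<nu> = 1")
  case False
  have pos: "inner g g > 0" using assms(2) ip_self_nonneg[of n g] by linarith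
  have lt: "\<nu> < 1" using eigfun_le_1[OF assms] False by simp
  have "inner (P g) (P g) = \<nu> * inner (P g) g"
    using eigfun_inner[OF assms(1)] .
  also have "inner (P g) g = \<nu> * inner g g"
    using eigfun_inner[OF assms(1), of g] by (simp add: ip_commute)
  finally have "\<nu> * (\<nu> * inner g g) + \<kappa> * (1 - 1 / \<gamma>) * Dir n E g \<le> inner g g"
    using norm_P_le[of g] by simp
  moreover have "\<kappa> * (1 - 1 / \<gamma>) * Dir n E g = 2 * (1 - 1 / \<gamma>) * ((1 - \<nu>) * inner g g)"
    unfolding eigfun_Dir[OF assms(1)] by simp
  ultimately have "2 * (1 - 1 / \<gamma>) * ((1 - \<nu>) * inner g g) \<le> (1 + \<nu>) * ((1 - \<nu>) * inner g g)"
    by (simp add: algebra_simps)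
  moreover have "(1 - \<nu>) * inner g g > 0" using pos lt by simp
  ultimately have "2 * (1 - 1 / \<gamma>) \<le> 1 + \<nu>"
    by (metis mult_le_cancel_right_pos)
  moreover have "1 / \<gamma> < 1" using gamma_gt_1 by simp
  ultimately show ?thesis by (simp add: algebra_simps)
qed simp

text \<open>At eigenvalue 1 the Dirichlet form vanishes, so the function agrees across every edge,
  hence along every path.\<close>

lemma eigfun_1_const:
  assumes "connected_on n E" "eigfun 1 g" "u < n" "v < n"
  shows "g u = g v"
proof -
  have "Dir n E g = 0"
    using eigfun_Dir[OF assms(2)] kappa_pos by simp
  then have "\<forall>u<n. (\<Sum>v\<in>N u. (g u - g v)\<^sup>2) = 0"
    unfolding Dir_def by (subst (asm) sum_nonneg_eq_0_iff) (auto intro: sum_nonneg)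
  then have "\<forall>u<n. \<forall>v\<in>N u. (g u - g v)\<^sup>2 = 0"
    by (subst (asm) sum_nonneg_eq_0_iff) auto
  then have edge: "g u = g v" if "E u v" for u v
    using that E_less[OF that] by (auto simp: nbrs_def)
  have "E\<^sup>*\<^sup>* u v"
    using assms by (simp add: connected_on_def)
  then show ?thesis by induction (auto simp: edge)
qed

section \<open>Matrix eigenvalues, real roots and Schur form\<close>

abbreviation A where "A \<equiv> Pmat \<gamma> n E"

lemma A_carrier [simp]: "A \<in> carrier_mat n n"
  by (simp add: Pmat_def)

lemma eigenvalue_eigfun: "eigenvalue A \<nu> \<longleftrightarrow> (\<exists>g. eigfun \<nu> g \<and> inner g g \<noteq> 0)"
proof
  assume "eigenvalue A \<nu>"
  then obtain v where v: "v \<in> carrier_vec n" "v \<noteq> 0\<^sub>v n" "A *\<^sub>v v = \<nu> \<cdot>\<^sub>v v"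
    by (auto simp: eigenvalue_def eigenvector_def Pmat_def)
  have "P (vec_index v) u = \<nu> * vec_index v u" if "u < n" for u
  proof -
    have "P (vec_index v) u = vec_index (A *\<^sub>v v) u"
      using that v(1) by (simp add: Pop_def Pmat_def scalar_prod_def atLeast0LessThan)
    then show ?thesis using v that by simp
  qed
  moreover have "\<exists>u<n. vec_index v u \<noteq> 0"
    using v(1,2) by (auto simp: vec_eq_iff)
  ultimately show "\<exists>g. eigfun \<nu> g \<and> inner g g \<noteq> 0"
    by (auto simp: ip_self_eq_0_iff eigfun_def intro!: exI[of _ "vec_index v"])
next
  assume "\<exists>g. eigfun \<nu> g \<and> inner g g \<noteq> 0"
  then obtain g where g: "eigfun \<nu> g" "\<exists>u<n. g u \<noteq> 0" by (auto simp: ip_self_eq_0_iff)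
  have "A *\<^sub>v vec n g = \<nu> \<cdot>\<^sub>v vec n g"
    using g(1) by (intro eq_vecI) (auto simp: eigfun_def Pop_def Pmat_def scalar_prod_def atLeast0LessThan)
  moreover have "vec n g \<noteq> 0\<^sub>v n"
    using g(2) by (auto simp: vec_eq_iff)
  ultimately show "eigenvalue A \<nu>"
    by (auto simp: eigenvalue_def eigenvector_def Pmat_def intro!: exI[of _ "vec n g"])
qed

lemma root_eigfun: "poly (char_poly A) \<nu> = 0 \<longleftrightarrow> (\<exists>g. eigfun \<nu> g \<and> inner g g \<noteq> 0)"
  using eigenvalue_root_char_poly[OF A_carrier] eigenvalue_eigfun by blast

text \<open>Split a complex eigenvector into real and imaginary parts g and h. Self-adjointness
  equates \<open>inner h (P g)\<close> with \<open>inner g (P h)\<close>, which leaves Im a times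
  the squared norm of the eigenvector equal to 0.\<close>

lemma complex_eigenvalue_real:
  assumes "eigenvalue (map_mat complex_of_real A) a"
  shows "Im a = 0"
proof -
  from assms obtain v where v: "v \<in> carrier_vec n" "v \<noteq> 0\<^sub>v n"
      "map_mat complex_of_real A *\<^sub>v v = a \<cdot>\<^sub>v v"
    by (auto simp: eigenvalue_def eigenvector_def Pmat_def)
  define g where "g = (\<lambda>u. Re (vec_index v u))"
  define h where "h = (\<lambda>u. Im (vec_index v u))"
  have eq: "(\<Sum>w<n. complex_of_real (Pent \<gamma> n E u w) * vec_index v w) = a * vec_index v u" if "u < n" for u
  proof -
    have "(\<Sum>w<n. complex_of_real (Pent \<gamma> n E u w) * vec_index v w)
        = vec_index (map_mat complex_of_real A *\<^sub>v v) u"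
      using that v(1) by (simp add: Pmat_def scalar_prod_def atLeast0LessThan)
    then show ?thesis using v that by simp
  qed
  have Pg: "P g u = Re a * g u - Im a * h u" if "u < n" for u
    using arg_cong[OF eq[OF that], of Re] by (simp add: Pop_def g_def h_def Re_sum)
  have Ph: "P h u = Re a * h u + Im a * g u" if "u < n" for u
    using arg_cong[OF eq[OF that], of Im] by (simp add: Pop_def g_def h_def Im_sum)
  have "inner h (P g) = inner h (\<lambda>u. Re a * g u - Im a * h u)"
    by (rule ip_cong) (auto simp: Pg)
  moreover have "inner g (P h) = inner g (\<lambda>u. Re a * h u + Im a * g u)"
    by (rule ip_cong) (auto simp: Ph)
  moreover have "inner g (\<lambda>u. Re a * h u + Im a * g u) = Re a * inner g h + Im a * inner g g"
    by (simp add: ip_add_right ip_scale_right)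
  moreover have "inner h (P g) = inner g (P h)"
    by (metis P_self_adjoint ip_commute)
  ultimately have "Im a * (inner g g + inner h h) = 0"
    using ip_commute[of n h g] by (simp add: ip_diff_right ip_scale_right algebra_simps)
  moreover have "inner g g + inner h h \<noteq> 0"
  proof
    assume "inner g g + inner h h = 0"
    then have "inner g g = 0" "inner h h = 0"
      using ip_self_nonneg[of n g] ip_self_nonneg[of n h] by linarith+
    then have "vec_index v u = 0" if "u < n" for u
      using that by (simp add: ip_self_eq_0_iff g_def h_def complex_eq_iff)
    then show False using v(1,2) by (auto simp: vec_eq_iff)
  qed
  ultimately show ?thesis by simp
qed

text \<open>The polynomial splits over the complex numbers and all its roots are real; the embedding
  of real polynomials is injective, so the factorization descends.\<close>

lemma char_poly_splits: "\<exists>es. char_poly A = (\<Prod>e\<leftarrow>es. [:-e, 1:]) \<and> length es = n"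
proof -
  let ?A = "map_mat complex_of_real A"
  have A': "?A \<in> carrier_mat n n" by simp
  obtain as where as: "char_poly ?A = (\<Prod>a\<leftarrow>as. [:-a, 1:])" "length as = n"
    using char_poly_factorized[OF A'] by blast
  have real: "complex_of_real (Re a) = a" if "a \<in> set as" for a
  proof -
    have "poly (char_poly ?A) a = 0"
      using that by (auto simp: as(1) poly_prod_list prod_list_zero_iff image_iff)
    then have "eigenvalue ?A a"
      by (simp add: eigenvalue_root_char_poly[OF A'])
    then show ?thesis
      using complex_eigenvalue_real by (simp add: complex_eq_iff)
  qed
  interpret h: map_poly_inj_idom_hom complex_of_real ..
  let ?es = "map Re as"
  have "map_poly complex_of_real (char_poly A) = (\<Prod>a\<leftarrow>as. [:-a, 1:])"
    using as(1) of_real_hom.char_poly_hom[OF A_carrier] by metis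
  also have "\<dots> = map_poly complex_of_real (\<Prod>e\<leftarrow>?es. [:-e, 1:])"
    unfolding h.hom_prod_list map_map
    by (intro arg_cong[where f = prod_list] map_cong refl) (auto simp: real)
  finally have "char_poly A = (\<Prod>e\<leftarrow>?es. [:-e, 1:])" by simp
  then show ?thesis using as(2) by (intro exI[of _ ?es]) simp
qed

text \<open>Schur's theorem restated for functions: \<open>p\<close> are the columns of the base
  change, \<open>q\<close> the rows of its inverse, hence dual to each other. In this basis
  \<open>P\<close> is only triangular; diagonality is extracted later from self-adjointness.\<close>

lemma schur_functions:
  assumes es: "char_poly A = (\<Prod>e\<leftarrow>es. [:-e, 1:])"
  obtains p q b where
    "\<And>j u. j < n \<Longrightarrow> u < n \<Longrightarrow> P (p j) u = es ! j * p j u + (\<Sum>i<j. b i j * p i u)"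
    "\<And>f u. u < n \<Longrightarrow> f u = (\<Sum>j<n. inner (q j) f * p j u)"
    "\<And>j k. j < n \<Longrightarrow> k < n \<Longrightarrow> inner (q j) (p k) = (if j = k then 1 else 0)"
proof -
  obtain B S T where BST: "schur_decomposition A es = (B, S, T)"
    by (cases "schur_decomposition A es") auto
  from schur_decomposition[OF A_carrier es this]
  have wit: "similar_mat_wit A B S T" and ut: "upper_triangular B" and dg: "diag_mat B = es"
    by auto
  note D = similar_mat_witD2(1,2,5-7)[OF A_carrier wit]
  have AS: "A * S = S * B"
  proof -
    have "A * S = (S * B * T) * S"
      using similar_mat_witD2(3)[OF A_carrier wit] by simp
    also have "\<dots> = (S * B) * (T * S)"
      using D(3-5) by (intro assoc_mult_mat[of _ n n _ n _ n]) auto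
    also have "\<dots> = S * B" unfolding D(2) using D(3-5) by (intro right_mult_one_mat[of _ n n]) auto
    finally show ?thesis .
  qed
  have dim [simp]: "dim_row S = n" "dim_col S = n" "dim_row B = n" "dim_col B = n"
      "dim_row T = n" "dim_col T = n"
    using D(3-5) by auto
  show thesis
  proof
    fix j u assume ju: "j < n" "u < n"
    have "P (\<lambda>v. S $$ (v, j)) u = (A * S) $$ (u, j)"
      using ju by (simp add: Pop_def Pmat_def scalar_prod_def atLeast0LessThan)
    also have "\<dots> = (\<Sum>i<n. S $$ (u, i) * B $$ (i, j))"
      unfolding AS using ju by (simp add: scalar_prod_def atLeast0LessThan)
    also have "\<dots> = (\<Sum>i<Suc j. S $$ (u, i) * B $$ (i, j))"
      using ju ut by (intro sum.mono_neutral_right) (auto simp: upper_triangular_def)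
    also have "B $$ (j, j) = es ! j"
      using ju dg by (auto simp: diag_mat_def)
    then have "(\<Sum>i<Suc j. S $$ (u, i) * B $$ (i, j)) =
        es ! j * S $$ (u, j) + (\<Sum>i<j. B $$ (i, j) * S $$ (u, i))"
      by (simp add: mult.commute)
    finally show "P (\<lambda>v. S $$ (v, j)) u = es ! j * S $$ (u, j) + (\<Sum>i<j. B $$ (i, j) * S $$ (u, i))" .
  next
    fix f :: "nat \<Rightarrow> real" and u assume u: "u < n"
    have "f u = vec_index (S * T *\<^sub>v vec n f) u"
      unfolding D(1) using u by simp
    also have "\<dots> = vec_index (S *\<^sub>v (T *\<^sub>v vec n f)) u"
      using D(3-5) by (subst assoc_mult_mat_vec[of _ n n _ n]) auto
    also have "\<dots> = (\<Sum>j<n. inner (\<lambda>v. T $$ (j, v)) f * S $$ (u, j))"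
      using u by (simp add: scalar_prod_def ip_def atLeast0LessThan mult.commute)
    finally show "f u = (\<Sum>j<n. inner (\<lambda>v. T $$ (j, v)) f * S $$ (u, j))" .
  next
    fix j k assume jk: "j < n" "k < n"
    have "inner (\<lambda>v. T $$ (j, v)) (\<lambda>v. S $$ (v, k)) = (T * S) $$ (j, k)"
      using jk by (simp add: scalar_prod_def ip_def atLeast0LessThan)
    then show "inner (\<lambda>v. T $$ (j, v)) (\<lambda>v. S $$ (v, k)) = (if j = k then 1 else 0)"
      unfolding D(2) using jk by simp
  qed
qed

end

text \<open>Allows the linear factors of the characteristic polynomial to be permuted, for sorting
  the roots and for bringing chosen roots to the front.\<close>

lemma prod_list_map_mset_cong:
  fixes f :: "'a \<Rightarrow> 'b::comm_monoid_mult"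
  assumes "mset xs = mset ys"
  shows "prod_list (map f xs) = prod_list (map f ys)"
proof -
  have "mset (map f xs) = mset (map f ys)" using assms by simp
  then show ?thesis by (simp only: prod_mset_prod_list[symmetric])
qed

section \<open>Diagonalization and the spectral gap\<close>

context diffusion
begin

lemma eigfun_inner_P: "eigfun \<nu> g \<Longrightarrow> inner g (P h) = \<nu> * inner g h"
  using eigfun_inner[of \<nu> g h] by (metis P_self_adjoint ip_commute)

text \<open>One component, possibly zero, is allotted to each value in a set without repetitions.
  Components of different values are then orthogonal, whatever the multiplicities.\<close>

definition eigsum :: "real set \<Rightarrow> (nat \<Rightarrow> real) \<Rightarrow> bool" where
  "eigsum S f \<longleftrightarrow> (\<exists>g. (\<forall>\<nu>\<in>S. eigfun \<nu> (g \<nu>)) \<and> (\<forall>u<n. f u = (\<Sum>\<nu>\<in>S. g \<nu> u)))"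

lemma eigsum_cong: "(\<And>u. u < n \<Longrightarrow> f u = f' u) \<Longrightarrow> eigsum S f \<longleftrightarrow> eigsum S f'"
  by (simp add: eigsum_def)

lemma eigsum_linear:
  assumes "eigsum S f" "eigsum S f'"
  shows "eigsum S (\<lambda>u. c * f u + d * f' u)"
proof -
  from assms obtain g g' where "\<forall>\<nu>\<in>S. eigfun \<nu> (g \<nu>)" "\<forall>u<n. f u = (\<Sum>\<nu>\<in>S. g \<nu> u)"
      "\<forall>\<nu>\<in>S. eigfun \<nu> (g' \<nu>)" "\<forall>u<n. f' u = (\<Sum>\<nu>\<in>S. g' \<nu> u)"
    unfolding eigsum_def by blast
  then show ?thesis unfolding eigsum_def
    by (intro exI[of _ "\<lambda>\<nu> u. c * g \<nu> u + d * g' \<nu> u"])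
      (auto simp: eigfun_linear sum.distrib sum_distrib_left)
qed

lemma eigsum_sum:
  assumes "finite I" "\<And>i. i \<in> I \<Longrightarrow> eigsum S (f i)"
  shows "eigsum S (\<lambda>u. \<Sum>i\<in>I. c i * f i u)"
  using assms
proof (induction rule: finite_induct)
  case empty
  show ?case unfolding eigsum_def
    by (intro exI[of _ "\<lambda>\<nu> u. 0"]) (auto simp: eigfun_def Pop_def)
next
  case (insert i I)
  then show ?case using eigsum_linear[of S "f i" "\<lambda>u. \<Sum>i\<in>I. c i * f i u" "c i" 1] by simp
qed

text \<open>The vector \<open>h\<close> below satisfies \<open>(P - e) h = g e\<close> and \<open>(P - e) (g e) = 0\<close>; for the
  self-adjoint \<open>P\<close> this forces \<open>g e = 0\<close>, so that \<open>h\<close> is itself an eigenvector.\<close>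

lemma eigsum_triangular:
  assumes S: "finite S" "e \<in> S" and w: "eigsum S w"
    and f: "\<And>u. u < n \<Longrightarrow> P f u = e * f u + w u"
  shows "eigsum S f"
proof -
  from w obtain g where g: "\<forall>\<nu>\<in>S. eigfun \<nu> (g \<nu>)" "\<forall>u<n. w u = (\<Sum>\<nu>\<in>S. g \<nu> u)"
    unfolding eigsum_def by blast
  define h where "h = (\<lambda>u. f u - (\<Sum>\<nu>\<in>S - {e}. 1 / (\<nu> - e) * g \<nu> u))"
  have Ph: "P h u = e * h u + g e u" if u: "u < n" for u
  proof -
    have "P h u = P f u - (\<Sum>\<nu>\<in>S - {e}. 1 / (\<nu> - e) * P (g \<nu>) u)"
      unfolding h_def Pop_diff Pop_sum Pop_scale ..
    also have "(\<Sum>\<nu>\<in>S - {e}. 1 / (\<nu> - e) * P (g \<nu>) u) =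
        (\<Sum>\<nu>\<in>S - {e}. e * (1 / (\<nu> - e) * g \<nu> u) + g \<nu> u)"
    proof (intro sum.cong refl)
      fix \<nu> assume "\<nu> \<in> S - {e}"
      then have "P (g \<nu>) u = \<nu> * g \<nu> u" "\<nu> - e \<noteq> 0" using g(1) u by (auto simp: eigfun_def)
      then show "1 / (\<nu> - e) * P (g \<nu>) u = e * (1 / (\<nu> - e) * g \<nu> u) + g \<nu> u"
        by (simp add: field_simps)
    qed
    also have "\<dots> = e * (\<Sum>\<nu>\<in>S - {e}. 1 / (\<nu> - e) * g \<nu> u) + (\<Sum>\<nu>\<in>S - {e}. g \<nu> u)"
      by (simp add: sum.distrib sum_distrib_left)
    also have "(\<Sum>\<nu>\<in>S - {e}. g \<nu> u) = w u - g e u"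
      using g(2) u S by (simp add: sum.remove[of S e])
    finally show ?thesis using f[OF u] by (simp add: h_def algebra_simps)
  qed
  have "inner (g e) (P h) = inner (g e) (\<lambda>u. e * h u + g e u)"
    by (rule ip_cong) (auto simp: Ph)
  also have "\<dots> = e * inner (g e) h + inner (g e) (g e)"
    by (simp add: ip_add_right ip_scale_right)
  also have "inner (g e) (P h) = e * inner (g e) h"
    using g(1) S(2) by (intro eigfun_inner_P) auto
  finally have "\<forall>u<n. g e u = 0" by (simp add: ip_self_eq_0_iff)
  then have h: "eigfun e h" using Ph by (simp add: eigfun_def)
  define g' where "g' = (\<lambda>\<nu> u. if \<nu> = e then h u else 1 / (\<nu> - e) * g \<nu> u)"
  have "eigfun \<nu> (g' \<nu>)" if "\<nu> \<in> S" for \<nu>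
    using h eigfun_linear[of \<nu> "g \<nu>" "g \<nu>" "1 / (\<nu> - e)" 0] g(1) that
    by (cases "\<nu> = e") (simp_all add: g'_def)
  moreover have "f u = (\<Sum>\<nu>\<in>S. g' \<nu> u)" for u
  proof -
    have "(\<Sum>\<nu>\<in>S. g' \<nu> u) = g' e u + (\<Sum>\<nu>\<in>S - {e}. g' \<nu> u)"
      using S by (rule sum.remove)
    also have "(\<Sum>\<nu>\<in>S - {e}. g' \<nu> u) = (\<Sum>\<nu>\<in>S - {e}. 1 / (\<nu> - e) * g \<nu> u)"
      by (intro sum.cong) (auto simp: g'_def)
    finally show ?thesis by (simp add: g'_def h_def)
  qed
  ultimately show ?thesis unfolding eigsum_def by blast
qed

text \<open>Each function of the Schur basis is handled by \<open>eigsum_triangular\<close> once its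
  predecessors are, and the basis spans everything.\<close>

lemma eigsum_all:
  assumes es: "char_poly A = (\<Prod>e\<leftarrow>es. [:-e, 1:])" "length es = n"
  shows "eigsum (set es) f"
proof -
  obtain p q b where
      p: "\<And>j u. j < n \<Longrightarrow> u < n \<Longrightarrow> P (p j) u = es ! j * p j u + (\<Sum>i<j. b i j * p i u)"
    and q: "\<And>f u. u < n \<Longrightarrow> f u = (\<Sum>j<n. inner (q j) f * p j u)"
    by (rule schur_functions[OF es(1)]) blast
  have "j < n \<Longrightarrow> eigsum (set es) (p j)" for j
  proof (induction j rule: less_induct)
    case (less j)
    show ?case
    proof (rule eigsum_triangular[where e = "es ! j"])
      show "eigsum (set es) (\<lambda>u. \<Sum>i<j. b i j * p i u)"
        using less by (intro eigsum_sum) auto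
      show "P (p j) u = es ! j * p j u + (\<Sum>i<j. b i j * p i u)" if "u < n" for u
        using p less.prems that by blast
    qed (use less.prems es(2) in auto)
  qed
  then have "eigsum (set es) (\<lambda>u. \<Sum>j<n. inner (q j) f * p j u)"
    by (intro eigsum_sum) auto
  then show ?thesis by (subst eigsum_cong[OF q]) auto
qed

text \<open>If 1 were a double root, Schur form with both copies first would give P p0 = p0 and P p1
  = p1 + b p0. Self-adjointness forces b = 0, so by connectedness both functions are constant,
  against their independence. The algebraic multiplicity is what matters, since
  \<open>lambda2\<close> is read off the list of roots.\<close>

lemma eigenvalue_1_simple:
  assumes conn: "connected_on n E" and "n \<ge> 2"
  shows "char_poly A \<noteq> (\<Prod>e\<leftarrow>1 # 1 # es. [:-e, 1:])"
proof
  assume es: "char_poly A = (\<Prod>e\<leftarrow>1 # 1 # es. [:-e, 1:])"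
  obtain p q b where
      p: "\<And>j u. j < n \<Longrightarrow> u < n \<Longrightarrow> P (p j) u = (1 # 1 # es) ! j * p j u + (\<Sum>i<j. b i j * p i u)"
    and q: "\<And>j k. j < n \<Longrightarrow> k < n \<Longrightarrow> inner (q j) (p k) = (if j = k then 1 else 0)"
    by (rule schur_functions[OF es]) blast
  have e0: "eigfun 1 (p 0)"
    using p[of 0] \<open>n \<ge> 2\<close> by (simp add: eigfun_def)
  have P1: "P (p 1) u = p 1 u + b 0 1 * p 0 u" if "u < n" for u
  proof -
    have "1 < n" using \<open>n \<ge> 2\<close> by simp
    from p[OF this that] show ?thesis by (simp add: lessThan_Suc)
  qed
  have "inner (p 0) (P (p 1)) = inner (p 0) (\<lambda>u. p 1 u + b 0 1 * p 0 u)"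
    by (rule ip_cong[OF refl P1])
  also have "\<dots> = inner (p 0) (p 1) + b 0 1 * inner (p 0) (p 0)"
    by (simp add: ip_add_right ip_scale_right)
  also have "inner (p 0) (P (p 1)) = inner (p 0) (p 1)"
    using eigfun_inner_P[OF e0, of "p 1"] by simp
  finally have "b 0 1 * inner (p 0) (p 0) = 0" by simp
  moreover have "inner (p 0) (p 0) \<noteq> 0"
  proof
    assume "inner (p 0) (p 0) = 0"
    then have "inner (q 0) (p 0) = inner (q 0) (\<lambda>_. 0)"
      by (intro ip_cong) (auto simp: ip_self_eq_0_iff)
    then show False using q[of 0 0] \<open>n \<ge> 2\<close> by (simp add: ip_def)
  qed
  ultimately have e1: "eigfun 1 (p 1)"
    using P1 by (simp add: eigfun_def)
  have c: "inner (q j) (p k) = p k 0 * (\<Sum>u<n. q j u)" if "k = 0 \<or> k = 1" for j k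
  proof -
    have const: "p k u = p k 0" if "u < n" for u
      using \<open>k = 0 \<or> k = 1\<close> eigfun_1_const[OF conn e0 that, of 0] eigfun_1_const[OF conn e1 that, of 0]
        \<open>n \<ge> 2\<close> by auto
    have "inner (q j) (p k) = inner (q j) (\<lambda>_. p k 0)"
      by (rule ip_cong[OF refl const])
    then show ?thesis by (simp add: ip_def sum_distrib_left mult.commute)
  qed
  \<comment> \<open>The first equation makes the sum of \<open>q 0\<close> nonzero, so the second
    gives \<open>p 1 0 = 0\<close>, which contradicts the third.\<close>
  have "p 0 0 * (\<Sum>u<n. q 0 u) = 1" "p 1 0 * (\<Sum>u<n. q 0 u) = 0" "p 1 0 * (\<Sum>u<n. q 1 u) = 1"
    unfolding c[symmetric, OF disjI1[OF refl]] c[symmetric, OF disjI2[OF refl]]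
    using q[of 0 0] q[of 0 1] q[of 1 1] \<open>n \<ge> 2\<close> by simp_all
  then show False by auto
qed

text \<open>All roots lie in (-1, 1], and 1 is a root of multiplicity one, hence the last entry of
  the sorted list and the only entry equal to 1. Any other root lies between the first and the last
  but one, which are \<open>lambdan\<close> and \<open>lambda2\<close>.\<close>

lemma
  assumes conn: "connected_on n E" and n2: "n \<ge> 2"
  shows lam_less_1: "lam A < 1"
    and abs_eigenvalue_le_lam: "\<And>\<nu>. poly (char_poly A) \<nu> = 0 \<Longrightarrow> \<nu> \<noteq> 1 \<Longrightarrow> \<bar>\<nu>\<bar> \<le> lam A"
proof -
  obtain es where es: "char_poly A = (\<Prod>e\<leftarrow>es. [:-e, 1:])" "length es = n"
    using char_poly_splits by blast
  define L where "L = eigs_sorted A"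
  have "proots (char_poly A) = mset es"
    unfolding es(1) by (induction es) (simp_all add: proots_mult prod_list_zero_iff image_iff del: mult_pCons_left)
  then have mL: "mset L = mset es" and srt: "sorted L"
    by (simp_all add: L_def eigs_sorted_def)
  have len: "length L = n" using mL es(2) by (metis size_mset)
  have cp: "char_poly A = (\<Prod>e\<leftarrow>L. [:-e, 1:])"
    unfolding es(1) by (intro prod_list_map_mset_cong) (simp add: mL)
  have set_L: "\<nu> \<in> set L \<longleftrightarrow> poly (char_poly A) \<nu> = 0" for \<nu>
    by (auto simp: cp poly_prod_list prod_list_zero_iff image_iff)
  have one: "1 \<in> set L"
    unfolding set_L root_eigfun using n2
    by (intro exI[of _ "\<lambda>_. 1"]) (auto simp: eigfun_const ip_def)
  have bounds: "-1 < \<nu> \<and> \<nu> \<le> 1" if "\<nu> \<in> set L" for \<nu>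
    using that eigfun_le_1 eigfun_gt_neg_1 unfolding set_L root_eigfun by blast
  \<comment> \<open>Entry 1 of the reversed list, counted from 0, is the second largest
    root.\<close>
  have l2: "lambda2 A = L ! (n - 2)"
    using n2 len by (simp add: lambda2_def L_def[symmetric] rev_nth Suc_diff_Suc numeral_2_eq_2)
  have ln: "lambdan A = L ! 0" by (simp add: lambdan_def L_def)
  have ord: "L ! i \<le> L ! j" if "i \<le> j" "j < n" for i j
    using that srt len by (simp add: sorted_iff_nth_mono)
  have mem: "L ! i \<in> set L" if "i < n" for i using that len by simp
  have last: "L ! (n - 1) = 1"
  proof -
    obtain i where "i < n" "L ! i = 1" using one len by (metis in_set_conv_nth)
    then have "1 \<le> L ! (n - 1)" using ord[of i "n - 1"] by simp
    then show ?thesis using bounds[OF mem[of "n - 1"]] n2 by simp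
  qed
  have "L ! (n - 2) \<noteq> 1"
  proof
    assume eq: "L ! (n - 2) = 1"
    \<comment> \<open>The last two entries are both 1; moving them to the front exhibits a double
      root.\<close>
    have "drop (n - 2) L = L ! (n - 2) # drop (Suc (n - 2)) L"
      using len n2 by (intro Cons_nth_drop_Suc[symmetric]) simp
    also have "drop (Suc (n - 2)) L = L ! Suc (n - 2) # drop (Suc (Suc (n - 2))) L"
      using len n2 by (intro Cons_nth_drop_Suc[symmetric]) simp
    also have "Suc (n - 2) = n - 1" using n2 by simp
    finally have "drop (n - 2) L = [1, 1]"
      using len n2 eq last by simp
    then have "mset L = mset (1 # 1 # take (n - 2) L)"
      using arg_cong[OF append_take_drop_id[of "n - 2" L, symmetric], of mset] by simp
    then have "char_poly A = (\<Prod>e\<leftarrow>1 # 1 # take (n - 2) L. [:-e, 1:])"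
      unfolding cp by (rule prod_list_map_mset_cong)
    then show False using eigenvalue_1_simple[OF conn n2] by blast
  qed
  then have l2_less: "L ! (n - 2) < 1"
    using bounds[OF mem[of "n - 2"]] n2 by simp
  then show "lam A < 1"
    using bounds[OF mem[of "n - 2"]] bounds[OF mem[of 0]] ord[of 0 "n - 2"] n2
    by (auto simp: lam_def l2 ln abs_less_iff)
  fix \<nu> assume "poly (char_poly A) \<nu> = 0" "\<nu> \<noteq> 1"
  then obtain i where i: "i < n" "L ! i = \<nu>" using len by (metis set_L in_set_conv_nth)
  then have "i \<noteq> n - 1" using last \<open>\<nu> \<noteq> 1\<close> by auto
  then have "L ! 0 \<le> \<nu>" "\<nu> \<le> L ! (n - 2)"
    using i ord[of 0 i] ord[of i "n - 2"] by auto
  then show "\<bar>\<nu>\<bar> \<le> lam A"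
    by (auto simp: lam_def l2 ln)
qed

text \<open>Decompose f into orthogonal eigenfunctions, so that squared norms add up. Mean zero
  kills the component of eigenvalue 1, and \<open>P\<close> contracts each remaining one by at least
  \<open>lam A\<close>.\<close>

lemma norm_P_pow_le:
  assumes conn: "connected_on n E" and n2: "n \<ge> 2" and f: "inner f (\<lambda>_. 1) = 0"
  shows "inner ((P ^^ t) f) ((P ^^ t) f) \<le> lam A ^ (2 * t) * inner f f"
proof -
  obtain es where es: "char_poly A = (\<Prod>e\<leftarrow>es. [:-e, 1:])" "length es = n"
    using char_poly_splits by blast
  define S where "S = set es"
  have S: "finite S" by (simp add: S_def)
  have root: "poly (char_poly A) \<nu> = 0" if "\<nu> \<in> S" for \<nu>
    using that by (auto simp: es S_def poly_prod_list prod_list_zero_iff image_iff)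
  obtain g where "(\<forall>\<nu>\<in>S. eigfun \<nu> (g \<nu>)) \<and> (\<forall>u<n. f u = (\<Sum>\<nu>\<in>S. g \<nu> u))"
    using eigsum_all[OF es, of f] unfolding eigsum_def S_def by (elim exE)
  then have g: "\<And>\<nu>. \<nu> \<in> S \<Longrightarrow> eigfun \<nu> (g \<nu>)" "\<And>u. u < n \<Longrightarrow> f u = (\<Sum>\<nu>\<in>S. g \<nu> u)"
    by (blast, simp)
  have orth: "inner (g \<nu>) (g \<mu>) = 0" if "\<nu> \<in> S" "\<mu> \<in> S" "\<nu> \<noteq> \<mu>" for \<nu> \<mu>
    by (rule eigfun_orthogonal[OF g(1)[OF that(1)] g(1)[OF that(2)] that(3)])
  have pow: "(P ^^ t) f u = (\<Sum>\<nu>\<in>S. \<nu> ^ t * g \<nu> u)" if "u < n" for t u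
    using that
  proof (induction t arbitrary: u)
    case (Suc t)
    have "P ((P ^^ t) f) = P (\<lambda>u. \<Sum>\<nu>\<in>S. \<nu> ^ t * g \<nu> u)"
      by (rule Pop_cong) (rule Suc.IH)
    then have "P ((P ^^ t) f) u = P (\<lambda>u. \<Sum>\<nu>\<in>S. \<nu> ^ t * g \<nu> u) u" by simp
    also have "\<dots> = (\<Sum>\<nu>\<in>S. \<nu> ^ Suc t * g \<nu> u)"
      unfolding Pop_sum Pop_scale using g(1) Suc.prems by (intro sum.cong) (auto simp: eigfun_def)
    finally show ?case by simp
  qed (simp add: g(2))
  have norm: "inner ((P ^^ t) f) ((P ^^ t) f) = (\<Sum>\<nu>\<in>S. \<nu> ^ (2 * t) * inner (g \<nu>) (g \<nu>))" for t
  proof -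
    have "inner ((P ^^ t) f) ((P ^^ t) f) =
        inner (\<lambda>u. \<Sum>\<nu>\<in>S. \<nu> ^ t * g \<nu> u) (\<lambda>u. \<Sum>\<nu>\<in>S. \<nu> ^ t * g \<nu> u)"
      by (rule ip_cong; rule pow)
    also have "\<dots> = (\<Sum>\<nu>\<in>S. \<Sum>\<mu>\<in>S. \<nu> ^ t * (\<mu> ^ t * inner (g \<nu>) (g \<mu>)))"
      by (simp add: ip_sum_left ip_sum_right ip_scale_left ip_scale_right sum_distrib_left)
    also have "\<dots> = (\<Sum>\<nu>\<in>S. \<Sum>\<mu>\<in>S. if \<mu> = \<nu> then \<nu> ^ (2 * t) * inner (g \<nu>) (g \<nu>) else 0)"
      by (intro sum.cong refl) (auto simp: orth mult_2 power_add)
    finally show ?thesis by (simp add: S)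
  qed
  have g1: "inner (g 1) (g 1) = 0" if "1 \<in> S"
  proof -
    have "inner f (\<lambda>_. 1) = inner (\<lambda>u. \<Sum>\<nu>\<in>S. g \<nu> u) (\<lambda>_. 1)"
      by (rule ip_cong) (simp_all add: g(2))
    also have "\<dots> = (\<Sum>\<nu>\<in>S. inner (g \<nu>) (\<lambda>_. 1))" by (rule ip_sum_left)
    also have "\<dots> = (\<Sum>\<nu>\<in>S. if \<nu> = 1 then inner (g 1) (\<lambda>_. 1) else 0)"
      using g(1) eigfun_orthogonal[OF _ eigfun_const] by (intro sum.cong) auto
    also have "\<dots> = inner (g 1) (\<lambda>_. 1)" using that S by (subst sum.delta) auto
    finally have s: "inner (g 1) (\<lambda>_. 1) = 0" unfolding f ..
    have const: "g 1 u = g 1 0" if "u < n" for u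
      using eigfun_1_const[OF conn g(1)[OF \<open>1 \<in> S\<close>] that, of 0] n_pos by simp
    have c: "inner h (g 1) = g 1 0 * inner h (\<lambda>_. 1)" for h
      unfolding ip_scale_right[symmetric] mult_1_right by (rule ip_cong[OF refl const])
    show ?thesis unfolding c s by simp
  qed
  have "lam A \<ge> 0" by (simp add: lam_def)
  have "(\<Sum>\<nu>\<in>S. \<nu> ^ (2 * t) * inner (g \<nu>) (g \<nu>)) \<le> (\<Sum>\<nu>\<in>S. lam A ^ (2 * t) * inner (g \<nu>) (g \<nu>))"
  proof (rule sum_mono)
    fix \<nu> assume \<nu>: "\<nu> \<in> S"
    show "\<nu> ^ (2 * t) * inner (g \<nu>) (g \<nu>) \<le> lam A ^ (2 * t) * inner (g \<nu>) (g \<nu>)"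
    proof (cases "\<nu> = 1")
      case False
      \<comment> \<open>The exponent is even, so a negative \<nu> may be replaced by its absolute
        value.\<close>
      have "\<nu> ^ (2 * t) = \<bar>\<nu>\<bar> ^ (2 * t)" by (simp add: power_mult)
      also have "\<dots> \<le> lam A ^ (2 * t)"
        using abs_eigenvalue_le_lam[OF conn n2 root[OF \<nu>] False] by (intro power_mono) auto
      finally show ?thesis by (intro mult_right_mono ip_self_nonneg)
    qed (use g1 \<nu> in auto)
  qed
  then show ?thesis
    using norm[of t] norm[of 0] by (simp add: sum_distrib_left)
qed

end

section \<open>Exponential moments\<close>

lemma hoeffding_pmf:
  fixes p :: "'a pmf" and X :: "'a \<Rightarrow> real"
  assumes "\<And>x. x \<in> set_pmf p \<Longrightarrow> X x \<in> {a..b}"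
  shows "(\<integral>\<^sup>+x. exp (X x - measure_pmf.expectation p X) \<partial>p) \<le> ennreal (exp ((b - a)\<^sup>2 / 8))"
proof -
  interpret interval_bounded_random_variable "measure_pmf p" X a b
    by unfold_locales (use assms in \<open>auto simp: AE_measure_pmf_iff\<close>)
  show ?thesis using Hoeffdings_lemma_nn_integral[of 1] by simp
qed

text \<open>Uncentred form of Hoeffding's lemma, with c a free upper bound for an eighth of the
  squared width of the range.\<close>

lemma hoeffding_mgf_pmf:
  fixes p :: "'a pmf" and X :: "'a \<Rightarrow> real"
  assumes "\<And>x. x \<in> set_pmf p \<Longrightarrow> X x \<in> {a..b}"
    and "measure_pmf.expectation p X = \<mu>" and "(b - a)\<^sup>2 \<le> 8 * c"
  shows "(\<integral>\<^sup>+x. exp (X x) \<partial>p) \<le> ennreal (exp (\<mu> + c))"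
proof -
  have "(\<integral>\<^sup>+x. exp (X x) \<partial>p) = (\<integral>\<^sup>+x. ennreal (exp \<mu>) * ennreal (exp (X x - \<mu>)) \<partial>p)"
    by (simp add: ennreal_mult[symmetric] exp_add[symmetric])
  also have "\<dots> = ennreal (exp \<mu>) * (\<integral>\<^sup>+x. ennreal (exp (X x - \<mu>)) \<partial>p)"
    by (rule nn_integral_cmult) simp
  also have "\<dots> \<le> ennreal (exp \<mu>) * ennreal (exp c)"
  proof (rule mult_left_mono)
    have "(\<integral>\<^sup>+x. ennreal (exp (X x - \<mu>)) \<partial>p) \<le> ennreal (exp ((b - a)\<^sup>2 / 8))"
      using hoeffding_pmf[of p X a b] assms(1,2) by simp
    also have "\<dots> \<le> ennreal (exp c)"
      using assms(3) by (intro ennreal_leI) simp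
    finally show "(\<integral>\<^sup>+x. ennreal (exp (X x - \<mu>)) \<partial>p) \<le> ennreal (exp c)" .
  qed simp
  also have "\<dots> = ennreal (exp (\<mu> + c))"
    by (simp add: ennreal_mult[symmetric] exp_add)
  finally show ?thesis .
qed

lemma nn_integral_exp_sum_Pi_pmf_le:
  fixes X :: "'i \<Rightarrow> 'a \<Rightarrow> real" and p :: "'i \<Rightarrow> 'a pmf"
  assumes "finite I" "\<And>i. i \<in> I \<Longrightarrow> (\<integral>\<^sup>+x. exp (X i x) \<partial>p i) \<le> ennreal (exp (b i))"
  shows "(\<integral>\<^sup>+f. exp (\<Sum>i\<in>I. X i (f i)) \<partial>Pi_pmf I dflt p) \<le> ennreal (exp (\<Sum>i\<in>I. b i))"
proof -
  have "(\<integral>\<^sup>+f. exp (\<Sum>i\<in>I. X i (f i)) \<partial>Pi_pmf I dflt p) =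
      (\<integral>\<^sup>+f. (\<Prod>i\<in>I. ennreal (exp (X i (f i)))) \<partial>Pi_pmf I dflt p)"
    by (simp add: exp_sum[OF assms(1)] prod_ennreal)
  also have "\<dots> = (\<Prod>i\<in>I. \<integral>\<^sup>+x. exp (X i x) \<partial>p i)"
    by (rule nn_integral_prod_Pi_pmf[OF assms(1)])
  also have "\<dots> \<le> (\<Prod>i\<in>I. ennreal (exp (b i)))"
    by (intro prod_mono_ennreal assms(2))
  also have "\<dots> = ennreal (exp (\<Sum>i\<in>I. b i))"
    by (simp add: exp_sum[OF assms(1)] prod_ennreal)
  finally show ?thesis .
qed

lemma chernoff_pmf:
  fixes p :: "'a pmf" and h :: "'a \<Rightarrow> real"
  assumes "(\<integral>\<^sup>+x. exp (h x) \<partial>p) \<le> ennreal (exp b)"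
  shows "measure_pmf.prob p {x. h x \<ge> s} \<le> exp (b - s)"
proof -
  have "emeasure p {x. h x \<ge> s} = (\<integral>\<^sup>+x. indicator {x. h x \<ge> s} x \<partial>p)"
    by simp
  also have "\<dots> \<le> (\<integral>\<^sup>+x. ennreal (exp (- s)) * ennreal (exp (h x)) \<partial>p)"
  proof (rule nn_integral_mono)
    fix x
    show "indicator {x. h x \<ge> s} x \<le> ennreal (exp (- s)) * ennreal (exp (h x))"
    proof (cases "h x \<ge> s")
      case True
      then have "ennreal 1 \<le> ennreal (exp (- s + h x))"
        by (intro ennreal_leI) simp
      also have "\<dots> = ennreal (exp (- s)) * ennreal (exp (h x))"
        unfolding exp_add by (rule ennreal_mult) auto
      finally show ?thesis using True by simp
    qed simp
  qed
  also have "\<dots> = ennreal (exp (- s)) * (\<integral>\<^sup>+x. exp (h x) \<partial>p)"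
    by (rule nn_integral_cmult) simp
  also have "\<dots> \<le> ennreal (exp (- s)) * ennreal (exp b)"
    using assms by (intro mult_left_mono) auto
  also have "\<dots> = ennreal (exp (b - s))"
    by (simp add: ennreal_mult[symmetric] exp_add[symmetric])
  finally show ?thesis
    by (simp add: measure_pmf.emeasure_eq_measure)
qed

text \<open>Chernoff's bound for the 2n events of an upper or lower deviation at some vertex: each
  has probability at most \<open>1 / real n ^ 3\<close>, and 2 / (n n) \<le> 1/n as n \<ge>
  2.\<close>

lemma subgaussian_max_bound:
  fixes p :: "(nat \<Rightarrow> int) pmf" and m :: "nat \<Rightarrow> real" and n :: nat
  assumes n: "n \<ge> 2" and V: "V > 0"
    and mgf: "\<And>w \<theta>. w < n \<Longrightarrow> (\<integral>\<^sup>+x. exp (\<theta> * real_of_int (x w)) \<partial>measure_pmf p) \<le> ennreal (exp (\<theta> * m w + V * \<theta>\<^sup>2))"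
  shows "measure_pmf.prob p {x. \<forall>w<n. \<bar>real_of_int (x w) - m w\<bar> \<le> 4 * sqrt (V * ln (real n))} \<ge> 1 - 1 / real n"
proof -
  let ?r = "4 * sqrt (V * ln (real n))"
  \<comment> \<open>With this choice V \<theta>\<theta> = ln n and \<theta> times the radius is 4 ln
    n, so every Chernoff exponent equals -3 ln n.\<close>
  define \<theta> where "\<theta> = sqrt (ln (real n) / V)"
  have L: "ln (real n) > 0" using n by simp
  have \<theta>: "\<theta> > 0" "\<theta>\<^sup>2 = ln (real n) / V" using L V by (simp_all add: \<theta>_def)
  have \<theta>r: "\<theta> * ?r = 4 * ln (real n)"
    using L V by (simp add: \<theta>_def real_sqrt_mult real_sqrt_divide)
  have "V * \<theta>\<^sup>2 = ln (real n)" using V \<theta>(2) by simp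
  have n3: "exp (- 3 * ln (real n)) = 1 / real n ^ 3"
    using n by (simp add: exp_minus exp_of_nat_mult[of 3, simplified] inverse_eq_divide)
  \<comment> \<open>The sign s selects the upper tail (1) or the lower tail (-1) at w.\<close>
  let ?B = "\<lambda>(w, s). {x. s * \<theta> * real_of_int (x w) \<ge> s * \<theta> * m w + \<theta> * ?r}"
  let ?I = "{..<n} \<times> {1, -1 :: real}"
  have tail: "measure_pmf.prob p (?B i) \<le> 1 / real n ^ 3" if "i \<in> ?I" for i
  proof -
    obtain w s where i: "i = (w, s)" "w < n" "s = 1 \<or> s = -1" using \<open>i \<in> ?I\<close> by auto
    have "measure_pmf.prob p (?B i) \<le>
        exp (s * \<theta> * m w + V * (s * \<theta>)\<^sup>2 - (s * \<theta> * m w + \<theta> * ?r))"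
      unfolding i(1) prod.case by (rule chernoff_pmf) (rule mgf[OF i(2)])
    also have "V * (s * \<theta>)\<^sup>2 = ln (real n)"
      using i(3) \<open>V * \<theta>\<^sup>2 = ln (real n)\<close> by (auto simp: power_mult_distrib)
    also have "exp (s * \<theta> * m w + ln (real n) - (s * \<theta> * m w + \<theta> * ?r)) = exp (- 3 * ln (real n))"
      unfolding \<theta>r by simp
    finally show ?thesis unfolding n3 .
  qed
  let ?G = "{x. \<forall>w<n. \<bar>real_of_int (x w) - m w\<bar> \<le> ?r}"
  have sub: "- ?G \<subseteq> (\<Union>i\<in>?I. ?B i)"
  proof
    fix x assume "x \<in> - ?G"
    then obtain w where w: "w < n" "\<bar>real_of_int (x w) - m w\<bar> > ?r" by (auto simp: not_le)
    define s :: real where "s = (if x w \<ge> m w then 1 else -1)"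
    have "s * (real_of_int (x w) - m w) \<ge> ?r"
      using w(2) by (auto simp: s_def)
    then have "\<theta> * (s * (real_of_int (x w) - m w)) \<ge> \<theta> * ?r"
      using \<theta>(1) by (intro mult_left_mono) auto
    then have "x \<in> ?B (w, s)" by (simp add: algebra_simps)
    moreover have "(w, s) \<in> ?I" using w(1) by (simp add: s_def)
    ultimately show "x \<in> (\<Union>i\<in>?I. ?B i)" by blast
  qed
  have "measure_pmf.prob p (- ?G) \<le> measure_pmf.prob p (\<Union>i\<in>?I. ?B i)"
    using sub by (intro measure_pmf.finite_measure_mono) auto
  also have "\<dots> \<le> (\<Sum>i\<in>?I. measure_pmf.prob p (?B i))"
    by (intro measure_pmf.finite_measure_subadditive_finite) auto
  also have "\<dots> \<le> (\<Sum>i\<in>?I. 1 / real n ^ 3)" by (intro sum_mono tail)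
  also have "\<dots> = 2 * real n / real n ^ 3" by (simp add: card_cartesian_product)
  also have "\<dots> \<le> 1 / real n"
    using n by (simp add: field_simps power3_eq_cube)
  finally have "measure_pmf.prob p (- ?G) \<le> 1 / real n" .
  moreover have "measure_pmf.prob p (- ?G) = 1 - measure_pmf.prob p ?G"
    using measure_pmf.prob_compl[of ?G p] by (simp add: Compl_eq_Diff_UNIV)
  ultimately show ?thesis by linarith
qed

section \<open>Iterating a one-round moment bound\<close>

primrec iter_kernel :: "('a \<Rightarrow> 'a pmf) \<Rightarrow> 'a \<Rightarrow> nat \<Rightarrow> 'a pmf" where
  "iter_kernel K x 0 = return_pmf x"
| "iter_kernel K x (Suc t) = bind_pmf (iter_kernel K x t) K"

lemma edge_proc_eq: "edge_proc \<gamma> n E x0 t = iter_kernel (edge_step \<gamma> n E) x0 t"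
  by (induction t) auto

lemma vertex_proc_eq: "vertex_proc n E d x0 t = iter_kernel (vertex_step n E d) x0 t"
  by (induction t) auto

context diffusion
begin

abbreviation load :: "(nat \<Rightarrow> int) \<Rightarrow> nat \<Rightarrow> real" where
  "load x \<equiv> (\<lambda>w. real_of_int (x w))"

text \<open>The interface to the protocols: one round acts as \<open>P\<close> in the mean, with
  fluctuations controlled by the Dirichlet form of the test function. Quantifying over all
  \<open>a\<close> is what permits iteration.\<close>

definition subgaussian_step :: "((nat \<Rightarrow> int) \<Rightarrow> (nat \<Rightarrow> int) pmf) \<Rightarrow> real \<Rightarrow> bool" where
  "subgaussian_step K c \<longleftrightarrow>
     (\<forall>a x. (\<integral>\<^sup>+y. exp (inner a (load y)) \<partial>K x) \<le> ennreal (exp (inner (P a) (load x) + c * Dir n E a)))"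

text \<open>Conditioning on the state before the last round replaces the test function a by P a at
  the cost of \<open>c * Dir n E a\<close>; hence the induction with a arbitrary.\<close>

lemma iter_kernel_mgf:
  assumes "subgaussian_step K c"
  shows "(\<integral>\<^sup>+y. exp (inner a (load y)) \<partial>iter_kernel K x t) \<le>
     ennreal (exp (inner a ((P ^^ t) (load x)) + c * (\<Sum>s<t. Dir n E ((P ^^ s) a))))"
proof (induction t arbitrary: a)
  case (Suc t)
  have "(\<integral>\<^sup>+y. exp (inner a (load y)) \<partial>iter_kernel K x (Suc t)) =
      (\<integral>\<^sup>+z. \<integral>\<^sup>+y. exp (inner a (load y)) \<partial>K z \<partial>iter_kernel K x t)"
    by simp
  also have "\<dots> \<le> (\<integral>\<^sup>+z. ennreal (exp (c * Dir n E a)) * ennreal (exp (inner (P a) (load z))) \<partial>iter_kernel K x t)"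
    using assms by (intro nn_integral_mono)
      (auto simp: subgaussian_step_def ennreal_mult[symmetric] exp_add[symmetric] add.commute)
  also have "\<dots> = ennreal (exp (c * Dir n E a)) * (\<integral>\<^sup>+z. exp (inner (P a) (load z)) \<partial>iter_kernel K x t)"
    by (rule nn_integral_cmult) simp
  also have "\<dots> \<le> ennreal (exp (c * Dir n E a)) *
      ennreal (exp (inner (P a) ((P ^^ t) (load x)) + c * (\<Sum>s<t. Dir n E ((P ^^ s) (P a)))))"
    by (intro mult_left_mono Suc.IH) auto
  also have "\<dots> = ennreal (exp (c * Dir n E a +
      (inner (P a) ((P ^^ t) (load x)) + c * (\<Sum>s<t. Dir n E ((P ^^ s) (P a))))))"
    by (simp add: ennreal_mult[symmetric] exp_add)
  also have "c * Dir n E a + (inner (P a) ((P ^^ t) (load x)) + c * (\<Sum>s<t. Dir n E ((P ^^ s) (P a))))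
      = inner a ((P ^^ Suc t) (load x)) + c * (\<Sum>s<Suc t. Dir n E ((P ^^ s) a))"
    by (simp add: sum.lessThan_Suc_shift funpow_swap1[of P _ a, symmetric] P_self_adjoint distrib_left del: sum.lessThan_Suc)
  finally show ?case .
qed simp

text \<open>The test function \<theta> times the indicator of w has squared norm \<theta>\<theta>,
  and \<open>sum_Dir_le\<close> then bounds the accumulated cost uniformly in t.\<close>

lemma iter_kernel_subgaussian:
  assumes "subgaussian_step K c" "c \<ge> 0" "w < n"
  shows "(\<integral>\<^sup>+y. exp (\<theta> * real_of_int (y w)) \<partial>iter_kernel K x t) \<le>
     ennreal (exp (\<theta> * (P ^^ t) (load x) w + c / (\<kappa> * (1 - 1 / \<gamma>)) * \<theta>\<^sup>2))"
proof -
  define a where "a = (\<lambda>u. if u = w then \<theta> else 0)"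
  have a: "inner a f = \<theta> * f w" for f
    using \<open>w < n\<close> by (simp add: ip_def a_def if_distrib[of "\<lambda>z. z * _"] sum.delta cong: if_cong)
  have aa: "inner a a = \<theta>\<^sup>2"
    unfolding a by (simp add: a_def power2_eq_square)
  have "\<kappa> * (1 - 1 / \<gamma>) > 0" using kappa_pos gamma_gt_1 by simp
  then have "(\<Sum>s<t. Dir n E ((P ^^ s) a)) \<le> \<theta>\<^sup>2 / (\<kappa> * (1 - 1 / \<gamma>))"
    using sum_Dir_le[where f = a and t = t] aa by (simp add: pos_le_divide_eq mult.commute)
  from mult_left_mono[OF this \<open>c \<ge> 0\<close>]
  have "c * (\<Sum>s<t. Dir n E ((P ^^ s) a)) \<le> c / (\<kappa> * (1 - 1 / \<gamma>)) * \<theta>\<^sup>2"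
    by simp
  then show ?thesis
    by (intro order.trans[OF iter_kernel_mgf[OF assms(1), where a = a and t = t and x = x, unfolded a] ennreal_leI]) simp
qed

lemma iter_kernel_deviation:
  assumes "subgaussian_step K c" "c > 0" "n \<ge> 2"
  shows "measure_pmf.prob (iter_kernel K x t)
    {y. \<forall>w<n. \<bar>real_of_int (y w) - xi \<gamma> n E x t w\<bar> \<le> 4 * sqrt (c / (\<kappa> * (1 - 1 / \<gamma>)) * ln (real n))} \<ge> 1 - 1 / real n"
proof -
  have "\<kappa> * (1 - 1 / \<gamma>) > 0" using kappa_pos gamma_gt_1 by simp
  then show ?thesis unfolding xi_eq
    using assms by (intro subgaussian_max_bound iter_kernel_subgaussian) auto
qed

end

section \<open>The two protocols\<close>

lemma expectation_rround: "measure_pmf.expectation (rround y) (\<lambda>k. c * real_of_int k) = c * y"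
proof -
  define \<phi> where "\<phi> = y - of_int \<lfloor>y\<rfloor>"
  have \<phi>: "0 \<le> \<phi>" "\<phi> \<le> 1" unfolding \<phi>_def by linarith+
  have "measure_pmf.expectation (rround y) (\<lambda>k. c * real_of_int k) =
      \<phi> * (c * real_of_int \<lceil>y\<rceil>) + (1 - \<phi>) * (c * real_of_int \<lfloor>y\<rfloor>)"
    using \<phi> by (simp add: rround_def \<phi>_def[symmetric] algebra_simps)
  \<comment> \<open>The factor \<phi> is essential: for an integer y the ceiling is not the floor
    plus 1, but then \<phi> = 0.\<close>
  also have "\<phi> * real_of_int \<lceil>y\<rceil> = \<phi> * (real_of_int \<lfloor>y\<rfloor> + 1)"
    by (cases "y \<in> \<int>") (auto simp: \<phi>_def ceiling_altdef elim!: Ints_cases)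
  then have "\<phi> * (c * real_of_int \<lceil>y\<rceil>) = c * (\<phi> * (real_of_int \<lfloor>y\<rfloor> + 1))"
    by (metis mult.left_commute)
  then have "\<phi> * (c * real_of_int \<lceil>y\<rceil>) + (1 - \<phi>) * (c * real_of_int \<lfloor>y\<rfloor>) = c * (real_of_int \<lfloor>y\<rfloor> + \<phi>)"
    by (simp add: algebra_simps)
  finally show ?thesis by (simp add: \<phi>_def)
qed

text \<open>Floor and ceiling differ by at most 1, so the scaled value ranges over an interval of
  length at most |c|. Minimum and maximum cover both signs of c.\<close>

lemma rround_mgf:
  "(\<integral>\<^sup>+k. exp (c * real_of_int k) \<partial>measure_pmf (rround y)) \<le> ennreal (exp (c * y + c\<^sup>2 / 8))"
proof (rule hoeffding_mgf_pmf)
  let ?lo = "min (c * of_int \<lfloor>y\<rfloor>) (c * of_int \<lceil>y\<rceil>)" and ?hi = "max (c * of_int \<lfloor>y\<rfloor>) (c * of_int \<lceil>y\<rceil>)"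
  show "c * real_of_int k \<in> {?lo..?hi}" if "k \<in> set_pmf (rround y)" for k
    using that by (auto simp: rround_def split: if_splits)
  have "?hi - ?lo = \<bar>c\<bar> * \<bar>real_of_int (\<lceil>y\<rceil> - \<lfloor>y\<rfloor>)\<bar>"
    unfolding abs_mult[symmetric] of_int_diff right_diff_distrib by linarith
  moreover have "\<bar>real_of_int (\<lceil>y\<rceil> - \<lfloor>y\<rfloor>)\<bar> \<le> 1"
    using ceiling_diff_floor_le_1[of y] floor_le_ceiling[of y] by linarith
  ultimately have "?hi - ?lo \<le> \<bar>c\<bar>"
    using mult_left_mono[of "\<bar>real_of_int (\<lceil>y\<rceil> - \<lfloor>y\<rfloor>)\<bar>" 1 "\<bar>c\<bar>"] by simp
  then have "(?hi - ?lo)\<^sup>2 \<le> \<bar>c\<bar>\<^sup>2" by (intro power_mono) auto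
  then show "(?hi - ?lo)\<^sup>2 \<le> 8 * (c\<^sup>2 / 8)" by simp
qed (rule expectation_rround)

section \<open>Moments of sums over a uniformly random subset of fixed size\<close>

lemma expectation_random_subset_sum:
  fixes a :: "'a \<Rightarrow> real"
  assumes C: "finite C" "C \<noteq> {}" and r: "r \<le> card C"
  shows "measure_pmf.expectation (pmf_of_set {S. S \<subseteq> C \<and> card S = r}) (\<lambda>S. \<Sum>w\<in>S. a w)
     = real r / real (card C) * (\<Sum>w\<in>C. a w)"
proof -
  let ?F = "{S. S \<subseteq> C \<and> card S = r}"
  let ?m = "card C"
  have m: "?m > 0" using C by (simp add: card_gt_0_iff)
  have F: "finite ?F" "?F \<noteq> {}" "card ?F = ?m choose r"
    using C n_subsets[OF C(1), of r] obtain_subset_with_card_n[OF r] by auto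
  have cnt: "real (card {S \<in> ?F. w \<in> S}) = real r / real ?m * real (?m choose r)" if w: "w \<in> C" for w
  proof (cases r)
    case 0
    then have "{S \<in> ?F. w \<in> S} = {}" using finite_subset[OF _ C(1)] by auto
    then show ?thesis using 0 by (metis card.empty div_0 mult_zero_left of_nat_0)
  next
    case (Suc k)
    \<comment> \<open>Deleting w matches the r-subsets containing w with the (r-1)-subsets of the
      rest; the binomial absorption identity then gives the fraction r / card C.\<close>
    have "bij_betw (\<lambda>S. S - {w}) {S \<in> ?F. w \<in> S} {S. S \<subseteq> C - {w} \<and> card S = k}"
    proof (rule bij_betw_byWitness[where f' = "insert w"])
      show "(\<lambda>S. S - {w}) ` {S \<in> ?F. w \<in> S} \<subseteq> {S. S \<subseteq> C - {w} \<and> card S = k}"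
        using Suc C(1) by (auto dest: finite_subset)
      show "insert w ` {S. S \<subseteq> C - {w} \<and> card S = k} \<subseteq> {S \<in> ?F. w \<in> S}"
        using Suc finite_subset[OF _ finite_Diff[OF C(1), of "{w}"]] w by (auto simp: card_insert_if)
    qed auto
    then have "card {S \<in> ?F. w \<in> S} = (?m - 1) choose k"
      using n_subsets[of "C - {w}" k] C(1) w by (simp add: bij_betw_same_card)
    moreover have "r * (?m choose r) = ?m * ((?m - 1) choose k)"
      using times_binomial_minus1_eq[of r ?m] Suc by simp
    then have "real r * real (?m choose r) = real ?m * real ((?m - 1) choose k)"
      by (metis of_nat_mult)
    ultimately show ?thesis using m by (simp add: field_simps)
  qed
  have "(\<Sum>S\<in>?F. \<Sum>w\<in>S. a w) = (\<Sum>S\<in>?F. \<Sum>w\<in>{w \<in> C. w \<in> S}. a w)"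
    by (intro sum.cong) auto
  also have "\<dots> = (\<Sum>w\<in>C. \<Sum>S\<in>{S \<in> ?F. w \<in> S}. a w)"
    by (rule sum.swap_restrict[OF F(1) C(1)])
  also have "\<dots> = (\<Sum>w\<in>C. real r / real ?m * real (?m choose r) * a w)"
    by (intro sum.cong refl) (simp add: cnt del: mem_Collect_eq)
  also have "\<dots> = real (?m choose r) * (real r / real ?m * (\<Sum>w\<in>C. a w))"
    by (simp add: sum_distrib_left sum_divide_distrib mult_ac)
  finally show ?thesis
    using F r by (simp add: integral_pmf_of_set)
qed

text \<open>All subsets have size r, so \<open>real r * a u\<close> can be split off, and the range
  is measured by differences to the reference point u. In the vertex protocol u is the sender, and
  these are differences along edges.\<close>

lemma random_subset_mgf:
  fixes a :: "'a \<Rightarrow> real"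
  assumes C: "finite C" "u \<in> C" and r: "r \<le> card C"
  shows "(\<integral>\<^sup>+S. exp (\<Sum>w\<in>S. a w) \<partial>measure_pmf (pmf_of_set {S. S \<subseteq> C \<and> card S = r}))
    \<le> ennreal (exp (real r / real (card C) * (\<Sum>w\<in>C. a w) + (\<Sum>w\<in>C. \<bar>a u - a w\<bar>)\<^sup>2 / 8))"
proof (rule hoeffding_mgf_pmf)
  let ?F = "{S. S \<subseteq> C \<and> card S = r}"
  \<comment> \<open>The extreme case takes every negative, respectively every positive, difference;
    the width is thus the sum of their absolute values.\<close>
  let ?lo = "real r * a u - (\<Sum>w\<in>C. max 0 (a u - a w))"
  let ?hi = "real r * a u + (\<Sum>w\<in>C. max 0 (a w - a u))"
  have F: "finite ?F" "?F \<noteq> {}"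
    using C obtain_subset_with_card_n[OF r] by auto
  show "(\<Sum>w\<in>S. a w) \<in> {?lo..?hi}" if "S \<in> set_pmf (pmf_of_set ?F)" for S
  proof -
    have S: "S \<subseteq> C" "card S = r" using that F by auto
    have eq: "(\<Sum>w\<in>S. a w) = real r * a u + (\<Sum>w\<in>S. a w - a u)"
      by (simp add: sum_subtractf S(2))
    have "(\<Sum>w\<in>S. a w - a u) \<le> (\<Sum>w\<in>S. max 0 (a w - a u))" by (intro sum_mono) simp
    also have "\<dots> \<le> (\<Sum>w\<in>C. max 0 (a w - a u))" using C S by (intro sum_mono2) auto
    finally have 1: "(\<Sum>w\<in>S. a w - a u) \<le> (\<Sum>w\<in>C. max 0 (a w - a u))" .
    have "- (\<Sum>w\<in>S. a w - a u) \<le> (\<Sum>w\<in>S. max 0 (a u - a w))"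
      unfolding sum_negf[symmetric] by (intro sum_mono) simp
    also have "\<dots> \<le> (\<Sum>w\<in>C. max 0 (a u - a w))" using C S by (intro sum_mono2) auto
    finally show ?thesis using 1 eq by simp
  qed
  show "measure_pmf.expectation (pmf_of_set ?F) (\<lambda>S. \<Sum>w\<in>S. a w) = real r / real (card C) * (\<Sum>w\<in>C. a w)"
    using C r by (intro expectation_random_subset_sum) auto
  have "?hi - ?lo = (\<Sum>w\<in>C. max 0 (a w - a u) + max 0 (a u - a w))"
    by (simp add: sum.distrib)
  also have "\<dots> = (\<Sum>w\<in>C. \<bar>a u - a w\<bar>)" by (intro sum.cong) auto
  finally show "(?hi - ?lo)\<^sup>2 \<le> 8 * ((\<Sum>w\<in>C. \<bar>a u - a w\<bar>)\<^sup>2 / 8)" by simp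
qed

lemma regular_maxdeg:
  assumes "regular_on n E d" "n \<ge> 1"
  shows "maxdeg n E = d"
proof -
  have "deg n E ` {..<n} = (\<lambda>_. d) ` {..<n}"
    using assms(1) by (intro image_cong) (auto simp: regular_on_def)
  also have "\<dots> = {d}"
    using assms(2) by (intro image_constant[of 0]) auto
  finally show ?thesis by (simp add: maxdeg_def)
qed

section \<open>One round of the edge-based protocol\<close>

context diffusion
begin

lemma finite_edges_ord: "finite (edges_ord n E)"
  by (rule finite_subset[of _ "{..<n} \<times> {..<n}"]) (auto simp: edges_ord_def)

text \<open>The ordered adjacent pairs are the disjoint union of \<open>edges_ord n E\<close> and
  its image under swapping.\<close>

lemma sum_nbrs_edges:
  "(\<Sum>u<n. \<Sum>v\<in>N u. g u v) = (\<Sum>(u, v)\<in>edges_ord n E. g u v + g v u)"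
proof -
  let ?Eo = "edges_ord n E"
  have "(\<Sum>u<n. \<Sum>v\<in>N u. g u v) = (\<Sum>(u, v)\<in>Sigma {..<n} N. g u v)"
    by (rule sum.Sigma) auto
  also have "Sigma {..<n} N = ?Eo \<union> prod.swap ` ?Eo"
    using E_sym E_irrefl E_less by (force simp: edges_ord_def nbrs_def not_less_iff_gr_or_eq)
  also have "(\<Sum>(u, v)\<in>?Eo \<union> prod.swap ` ?Eo. g u v) =
      (\<Sum>(u, v)\<in>?Eo. g u v) + (\<Sum>(u, v)\<in>prod.swap ` ?Eo. g u v)"
    using finite_edges_ord by (intro sum.union_disjoint) (auto simp: edges_ord_def)
  also have "(\<Sum>(u, v)\<in>prod.swap ` ?Eo. g u v) = (\<Sum>(u, v)\<in>?Eo. g v u)"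
    by (subst sum.reindex) (auto simp: case_prod_unfold)
  finally show ?thesis by (simp add: sum.distrib case_prod_unfold)
qed

lemma sum_edges_out: "(\<Sum>w<n. \<Sum>v\<in>{v. (w, v) \<in> edges_ord n E}. h w v) = (\<Sum>(u, v)\<in>edges_ord n E. h u v)"
  and sum_edges_in: "(\<Sum>w<n. \<Sum>u\<in>{u. (u, w) \<in> edges_ord n E}. h w u) = (\<Sum>(u, v)\<in>edges_ord n E. h v u)"
proof -
  have fin: "finite {v. (w, v) \<in> edges_ord n E}" "finite {u. (u, w) \<in> edges_ord n E}" for w
    by (rule finite_subset[of _ "{..<n}"]; auto simp: edges_ord_def)+
  have "(\<Sum>w<n. \<Sum>v\<in>{v. (w, v) \<in> edges_ord n E}. h w v) =
      (\<Sum>(w, v)\<in>Sigma {..<n} (\<lambda>w. {v. (w, v) \<in> edges_ord n E}). h w v)"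
    using fin by (intro sum.Sigma) auto
  also have "Sigma {..<n} (\<lambda>w. {v. (w, v) \<in> edges_ord n E}) = edges_ord n E"
    by (auto simp: edges_ord_def)
  finally show "(\<Sum>w<n. \<Sum>v\<in>{v. (w, v) \<in> edges_ord n E}. h w v) = (\<Sum>(u, v)\<in>edges_ord n E. h u v)" .
  have "(\<Sum>w<n. \<Sum>u\<in>{u. (u, w) \<in> edges_ord n E}. h w u) =
      (\<Sum>(w, u)\<in>Sigma {..<n} (\<lambda>w. {u. (u, w) \<in> edges_ord n E}). h w u)"
    using fin by (intro sum.Sigma) auto
  also have "Sigma {..<n} (\<lambda>w. {u. (u, w) \<in> edges_ord n E}) = prod.swap ` edges_ord n E"
    by (force simp: edges_ord_def)
  also have "(\<Sum>(w, u)\<in>prod.swap ` edges_ord n E. h w u) = (\<Sum>(u, v)\<in>edges_ord n E. h v u)"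
    by (subst sum.reindex) (auto simp: case_prod_unfold)
  finally show "(\<Sum>w<n. \<Sum>u\<in>{u. (u, w) \<in> edges_ord n E}. h w u) = (\<Sum>(u, v)\<in>edges_ord n E. h v u)" .
qed

text \<open>A token sent from u to v changes \<open>inner a (load x)\<close> by a(v) - a(u), so the
  round contributes a sum of independent rounded flows with these weights. Unbiased rounding yields
  the mean, and Hoeffding adds an eighth of each squared weight.\<close>

lemma edge_step_subgaussian: "subgaussian_step (edge_step \<gamma> n E) (1 / 16)"
  unfolding subgaussian_step_def
proof (intro allI)
  fix a :: "nat \<Rightarrow> real" and x :: "nat \<Rightarrow> int"
  let ?Eo = "edges_ord n E"
  let ?y = "\<lambda>(u, v). real_of_int (x u - x v) / (\<gamma> * real (maxdeg n E))"
  let ?c = "\<lambda>(u, v). a v - a u"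
  let ?z = "\<lambda>f w. x w - (\<Sum>v\<in>{v. (w, v) \<in> ?Eo}. f (w, v)) + (\<Sum>u\<in>{u. (u, w) \<in> ?Eo}. f (u, w))"
  have z: "inner a (load (?z f)) = inner a (load x) + (\<Sum>e\<in>?Eo. ?c e * real_of_int (f e))" for f
  proof -
    have "inner a (load (?z f)) = inner a (load x)
        - (\<Sum>w<n. \<Sum>v\<in>{v. (w, v) \<in> ?Eo}. a w * real_of_int (f (w, v)))
        + (\<Sum>w<n. \<Sum>u\<in>{u. (u, w) \<in> ?Eo}. a w * real_of_int (f (u, w)))"
      by (simp add: ip_def algebra_simps sum.distrib sum_subtractf sum_distrib_left)
    also have "\<dots> = inner a (load x) - (\<Sum>(u, v)\<in>?Eo. a u * real_of_int (f (u, v)))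
        + (\<Sum>(u, v)\<in>?Eo. a v * real_of_int (f (u, v)))"
      by (simp only: sum_edges_out sum_edges_in)
    finally show ?thesis
      by (simp add: case_prod_unfold left_diff_distrib sum_subtractf)
  qed
  have mean: "inner a (load x) + (\<Sum>e\<in>?Eo. ?c e * ?y e) = inner (P a) (load x)"
  proof -
    have "inner a (load x) - inner (P a) (load x) =
        \<kappa> / 2 * (\<Sum>(u, v)\<in>?Eo. (a u - a v) * (load x u - load x v) + (a v - a u) * (load x v - load x u))"
      unfolding P_self_adjoint[symmetric] inner_laplacian sum_nbrs_edges ..
    also have "\<dots> = - (\<Sum>e\<in>?Eo. ?c e * ?y e)"
      unfolding sum_distrib_left sum_negf[symmetric]
    proof (intro sum.cong refl, clarify)
      fix u v
      have "- ((a v - a u) * (real_of_int (x u - x v) / (\<gamma> * real (maxdeg n E)))) = \<kappa> * ((a u - a v) * (load x u - load x v))"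
        by (simp add: \<kappa>_def minus_divide_left left_diff_distrib)
      moreover have "\<kappa> / 2 * ((a u - a v) * (load x u - load x v) + (a v - a u) * (load x v - load x u)) =
          \<kappa> * ((a u - a v) * (load x u - load x v))"
        by (simp add: algebra_simps)
      ultimately show "\<kappa> / 2 * ((a u - a v) * (load x u - load x v) + (a v - a u) * (load x v - load x u)) =
          - ((a v - a u) * (real_of_int (x u - x v) / (\<gamma> * real (maxdeg n E))))" by simp
    qed
    finally show ?thesis by simp
  qed
  \<comment> \<open>The Dirichlet form counts each edge twice, which turns 1/8 into 1/16.\<close>
  have var: "(\<Sum>e\<in>?Eo. (?c e)\<^sup>2 / 8) = 1 / 16 * Dir n E a"
    unfolding Dir_def sum_nbrs_edges sum_distrib_left
    by (intro sum.cong refl) (auto simp: power2_commute)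
  have kern: "(\<lambda>(u, v). rround (real_of_int (x u - x v) / (\<gamma> * real (maxdeg n E)))) = (\<lambda>e. rround (?y e))"
    by auto
  have "(\<integral>\<^sup>+y. exp (inner a (load y)) \<partial>edge_step \<gamma> n E x) =
      (\<integral>\<^sup>+f. ennreal (exp (inner a (load x))) * ennreal (exp (\<Sum>e\<in>?Eo. ?c e * real_of_int (f e)))
        \<partial>Pi_pmf ?Eo 0 (\<lambda>e. rround (?y e)))"
    unfolding edge_step_def kern nn_integral_map_pmf z exp_add
    by (simp only: ennreal_mult exp_ge_zero)
  also have "\<dots> = ennreal (exp (inner a (load x))) *
      (\<integral>\<^sup>+f. exp (\<Sum>e\<in>?Eo. ?c e * real_of_int (f e)) \<partial>Pi_pmf ?Eo 0 (\<lambda>e. rround (?y e)))"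
    by (rule nn_integral_cmult) simp
  also have "\<dots> \<le> ennreal (exp (inner a (load x))) * ennreal (exp (\<Sum>e\<in>?Eo. ?c e * ?y e + (?c e)\<^sup>2 / 8))"
    by (intro mult_left_mono nn_integral_exp_sum_Pi_pmf_le finite_edges_ord rround_mgf) simp
  also have "\<dots> = ennreal (exp (inner a (load x) + (\<Sum>e\<in>?Eo. ?c e * ?y e + (?c e)\<^sup>2 / 8)))"
    by (simp add: ennreal_mult[symmetric] exp_add)
  also have "inner a (load x) + (\<Sum>e\<in>?Eo. ?c e * ?y e + (?c e)\<^sup>2 / 8) = inner (P a) (load x) + 1 / 16 * Dir n E a"
    unfolding sum.distrib var mean[symmetric] by simp
  finally show "(\<integral>\<^sup>+y. exp (inner a (load y)) \<partial>edge_step \<gamma> n E x)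
      \<le> ennreal (exp (inner (P a) (load x) + 1 / 16 * Dir n E a))" .
qed

section \<open>One round of the vertex-based protocol\<close>

lemma kappa_regular:
  assumes "regular_on n E d" "d \<ge> 1" "\<gamma> = 1 + 1 / real d"
  shows "\<kappa> = 1 / (real d + 1)"
  using assms regular_maxdeg[OF assms(1) n_pos] by (simp add: \<kappa>_def field_simps)

text \<open>The deterministic shares and the mean of the random remainder add up to
  \<open>P\<close>. The remainder of u fluctuates in a range of width equal to the sum of |a(u) -
  a(w)| over its neighbours; Cauchy-Schwarz costs a factor d, and Hoeffding gives 1/8.\<close>

lemma vertex_step_subgaussian:
  assumes reg: "regular_on n E d" and d: "d \<ge> 1" and \<gamma>: "\<gamma> = 1 + 1 / real d"
  shows "subgaussian_step (vertex_step n E d) (real d / 8)"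
  unfolding subgaussian_step_def
proof (intro allI)
  fix a :: "nat \<Rightarrow> real" and x :: "nat \<Rightarrow> int"
  let ?C = "cnbhd n E"
  define q where "q u = x u div int (d + 1)" for u
  define r where "r u = nat (x u mod int (d + 1))" for u
  let ?p = "\<lambda>u. pmf_of_set {S. S \<subseteq> ?C u \<and> card S = r u}"
  have deg: "deg n E u = d" if "u < n" for u using reg that by (simp add: regular_on_def)
  note \<kappa> = kappa_regular[OF reg d \<gamma>]
  have C: "?C u = insert u (N u)" "u \<notin> N u" if "u < n" for u
    using that E_irrefl by (auto simp: cnbhd_def nbrs_def)
  have card_C: "card (?C u) = d + 1" if "u < n" for u
    using that by (simp add: C card_N deg)
  have finC: "finite (?C u)" for u by (simp add: cnbhd_def)
  have r_le: "r u \<le> card (?C u)" if "u < n" for u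
    using pos_mod_bound[of "int (d + 1)" "x u"] unfolding card_C[OF that] r_def by linarith
  have x_eq: "real_of_int (x u) = real_of_int (q u) * (real d + 1) + real (r u)" for u
  proof -
    have "x u = q u * int (d + 1) + int (r u)"
      using pos_mod_sign[of "int (d + 1)" "x u"] div_mult_mod_eq[of "x u" "int (d + 1)"]
      unfolding q_def r_def by simp
    then have "real_of_int (x u) = real_of_int (q u * int (d + 1) + int (r u))" by simp
    then show ?thesis by simp
  qed
  \<comment> \<open>For this \<gamma> all transition weights, including the holding weight, equal
    1/(d+1), so \<open>P\<close> averages over the closed neighbourhood.\<close>
  have Pa: "(\<Sum>w\<in>?C u. a w) = (real d + 1) * P a u" if "u < n" for u
    using d by (simp add: Pop_eq[OF that] C[OF that] \<kappa> sum_subtractf card_N deg[OF that] field_simps)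
  let ?z = "\<lambda>S w. (\<Sum>u\<in>{u. u < n \<and> w \<in> ?C u}. q u) + int (card {u. u < n \<and> w \<in> S u})"
  have z: "inner a (load (?z S)) = (\<Sum>u<n. q u * (\<Sum>w\<in>?C u. a w)) + (\<Sum>u<n. \<Sum>w\<in>S u. a w)"
    if S: "\<And>u. u < n \<Longrightarrow> S u \<subseteq> ?C u" for S
  proof -
    have sub: "{w \<in> {..<n}. w \<in> ?C u} = ?C u" for u by (auto simp: cnbhd_def)
    have subS: "{w \<in> {..<n}. w \<in> S u} = S u" if "u < n" for u
      using S[OF that] by (auto simp: cnbhd_def)
    have "inner a (load (?z S)) = (\<Sum>w<n. \<Sum>u\<in>{u \<in> {..<n}. w \<in> ?C u}. a w * real_of_int (q u))
        + (\<Sum>w<n. \<Sum>u\<in>{u \<in> {..<n}. w \<in> S u}. a w)"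
      by (simp add: ip_def algebra_simps sum.distrib sum_distrib_left)
    also have "(\<Sum>w<n. \<Sum>u\<in>{u \<in> {..<n}. w \<in> ?C u}. a w * real_of_int (q u)) =
        (\<Sum>u<n. \<Sum>w\<in>{w \<in> {..<n}. w \<in> ?C u}. a w * real_of_int (q u))"
      by (rule sum.swap_restrict) auto
    also have "(\<Sum>w<n. \<Sum>u\<in>{u \<in> {..<n}. w \<in> S u}. a w) = (\<Sum>u<n. \<Sum>w\<in>{w \<in> {..<n}. w \<in> S u}. a w)"
      by (rule sum.swap_restrict) auto
    also have "\<dots> = (\<Sum>u<n. \<Sum>w\<in>S u. a w)"
      using subS by (intro sum.cong refl) simp
    finally show ?thesis unfolding sub by (simp add: sum_distrib_left mult.commute)
  qed
  have supp: "S u \<subseteq> ?C u" if "S \<in> set_pmf (Pi_pmf {..<n} {} ?p)" "u < n" for S u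
  proof -
    have "S u \<in> set_pmf (?p u)"
      using that by (auto simp: set_Pi_pmf PiE_dflt_def)
    moreover obtain T where "T \<subseteq> ?C u" "card T = r u"
      by (rule obtain_subset_with_card_n[OF r_le[OF \<open>u < n\<close>]])
    then have "finite {S. S \<subseteq> ?C u \<and> card S = r u}" "{S. S \<subseteq> ?C u \<and> card S = r u} \<noteq> {}"
      using finC by auto
    ultimately show ?thesis by simp
  qed
  let ?D = "\<Sum>u<n. real_of_int (q u) * (\<Sum>w\<in>?C u. a w)"
  have L: "(\<Sum>w\<in>?C u. \<bar>a u - a w\<bar>)\<^sup>2 / 8 \<le> real d / 8 * (\<Sum>w\<in>N u. (a u - a w)\<^sup>2)" if "u < n" for u
  proof -
    have "(\<Sum>w\<in>?C u. \<bar>a u - a w\<bar>) = (\<Sum>w\<in>N u. \<bar>a u - a w\<bar>)"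
      by (simp add: C[OF that])
    moreover have "(\<Sum>w\<in>N u. \<bar>a u - a w\<bar>)\<^sup>2 \<le> real d * (\<Sum>w\<in>N u. (a u - a w)\<^sup>2)"
      using Cauchy_Schwarz_ineq_sum[of "\<lambda>v. 1" "\<lambda>v. \<bar>a u - a v\<bar>" "N u"] by (simp add: card_N deg[OF that])
    ultimately show ?thesis by simp
  qed
  \<comment> \<open>Quotient plus r/(d+1) is x(u)/(d+1), and the factor d+1 from \<open>Pa\<close>
    cancels the denominator.\<close>
  have mean: "?D + (\<Sum>u<n. real (r u) / real (card (?C u)) * (\<Sum>w\<in>?C u. a w)) = inner (P a) (load x)"
    unfolding ip_def sum.distrib[symmetric]
    by (intro sum.cong refl) (auto simp: Pa card_C x_eq field_simps)
  have "(\<integral>\<^sup>+y. exp (inner a (load y)) \<partial>vertex_step n E d x) =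
      (\<integral>\<^sup>+S. exp (inner a (load (?z S))) \<partial>Pi_pmf {..<n} {} ?p)"
    by (simp add: vertex_step_def q_def r_def nn_integral_map_pmf)
  \<comment> \<open>The identity \<open>z\<close> requires each chosen set to lie in the closed
    neighbourhood, so the integrands are compared on the support only.\<close>
  also have "\<dots> = (\<integral>\<^sup>+S. ennreal (exp ?D) * ennreal (exp (\<Sum>u<n. \<Sum>w\<in>S u. a w)) \<partial>Pi_pmf {..<n} {} ?p)"
  proof (intro nn_integral_cong_AE AE_pmfI)
    fix S assume "S \<in> set_pmf (Pi_pmf {..<n} {} ?p)"
    from z[OF supp[OF this]]
    show "ennreal (exp (inner a (load (?z S)))) = ennreal (exp ?D) * ennreal (exp (\<Sum>u<n. \<Sum>w\<in>S u. a w))"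
      by (simp only: exp_add ennreal_mult exp_ge_zero)
  qed
  also have "\<dots> = ennreal (exp ?D) * (\<integral>\<^sup>+S. exp (\<Sum>u<n. \<Sum>w\<in>S u. a w) \<partial>Pi_pmf {..<n} {} ?p)"
    by (rule nn_integral_cmult) simp
  also have "\<dots> \<le> ennreal (exp ?D) * ennreal (exp (\<Sum>u<n. real (r u) / real (card (?C u)) * (\<Sum>w\<in>?C u. a w) +
      (\<Sum>w\<in>?C u. \<bar>a u - a w\<bar>)\<^sup>2 / 8))"
    using r_le finC C by (intro mult_left_mono nn_integral_exp_sum_Pi_pmf_le random_subset_mgf) auto
  also have "\<dots> = ennreal (exp (?D + (\<Sum>u<n. real (r u) / real (card (?C u)) * (\<Sum>w\<in>?C u. a w) +
      (\<Sum>w\<in>?C u. \<bar>a u - a w\<bar>)\<^sup>2 / 8)))"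
    by (simp add: ennreal_mult[symmetric] exp_add)
  also have "\<dots> = ennreal (exp (inner (P a) (load x) + (\<Sum>u<n. (\<Sum>w\<in>?C u. \<bar>a u - a w\<bar>)\<^sup>2 / 8)))"
    unfolding mean[symmetric] by (simp add: sum.distrib add.assoc)
  also have "\<dots> \<le> ennreal (exp (inner (P a) (load x) + real d / 8 * Dir n E a))"
    unfolding Dir_def sum_distrib_left[of "real d / 8" _ "{..<n}"]
    using L by (intro ennreal_leI iffD2[OF exp_le_cancel_iff] add_left_mono sum_mono) simp
  finally show "(\<integral>\<^sup>+y. exp (inner a (load y)) \<partial>vertex_step n E d x)
      \<le> ennreal (exp (inner (P a) (load x) + real d / 8 * Dir n E a))" .
qed

end

section \<open>Discrepancy\<close>

lemma discK_ge: "u < n \<Longrightarrow> v < n \<Longrightarrow> \<bar>x u - x v\<bar> \<le> discK n x"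
proof -
  assume uv: "u < n" "v < n"
  have "{\<bar>x u - x v\<bar> | u v. u < n \<and> v < n} = (\<lambda>(u, v). \<bar>x u - x v\<bar>) ` ({..<n} \<times> {..<n})"
    by auto
  then have "finite {\<bar>x u - x v\<bar> | u v. u < n \<and> v < n}" by simp
  then show ?thesis unfolding discK_def using uv by (intro Max_ge) auto
qed

text \<open>With at least two vertices, a path from 0 to 1 starts with an edge at 0, so the maximum
  degree is positive.\<close>

lemma diffusionI:
  assumes "graph_on n E" "connected_on n E" "n \<ge> 2" "\<gamma> > 1"
  shows "diffusion \<gamma> n E"
proof
  have "E\<^sup>*\<^sup>* 0 1" using assms by (simp add: connected_on_def)
  then obtain v where v: "E 0 v"
    by (metis converse_rtranclpE zero_neq_one)
  then have "v < n" using assms(1) by (auto simp: graph_on_def)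
  then have "deg n E 0 \<ge> 1"
    using v by (auto simp: deg_def Suc_le_eq card_gt_0_iff)
  also have "deg n E 0 \<le> maxdeg n E"
    unfolding maxdeg_def using assms(3) by (intro Max_ge) auto
  finally show "maxdeg n E \<ge> 1" .
qed (use assms in auto)

context diffusion
begin

lemma P_pow_add: "(P ^^ t) (\<lambda>u. f u + g u) = (\<lambda>u. (P ^^ t) f u + (P ^^ t) g u)"
  by (induction t) (simp_all add: Pop_add)

text \<open>The centred load f has squared norm at most nKK, and \<open>lam A ^ t\<close> is at most
  1/(Kn). The centred part therefore has squared norm at most 1 at time t, so each value is within 1
  of the average and any two are within 2.\<close>

lemma xi_discrepancy_le:
  assumes conn: "connected_on n E" and n2: "n \<ge> 2"
    and t: "real t \<ge> ln (real_of_int (discK n x) * real n) / (1 - lam A)"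
    and uv: "u < n" "v < n"
  shows "\<bar>xi \<gamma> n E x t u - xi \<gamma> n E x t v\<bar> \<le> 2"
proof -
  define avg where "avg = (\<Sum>w<n. load x w) / n"
  define f where "f = (\<lambda>w. load x w - avg)"
  define K where "K = real_of_int (discK n x)"
  have K: "\<bar>load x w - load x w'\<bar> \<le> K" if "w < n" "w' < n" for w w'
    using discK_ge[OF that, of x] by (simp add: K_def flip: of_int_diff of_int_abs)
  have "K \<ge> 0" using K[of 0 0] n_pos by simp
  have mean0: "inner f (\<lambda>_. 1) = 0"
    using n2 by (simp add: ip_def f_def avg_def sum_subtractf)
  have f_le: "\<bar>f w\<bar> \<le> K" if w: "w < n" for w
  proof -
    have "real n * f w = (\<Sum>w'<n. load x w - load x w')"
      using n2 by (simp add: f_def avg_def sum_subtractf right_diff_distrib)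
    also have "\<bar>\<dots>\<bar> \<le> (\<Sum>w'<n. K)"
      by (intro order.trans[OF sum_abs] sum_mono K) (use w in auto)
    finally have "real n * \<bar>f w\<bar> \<le> real n * K" using n2 by (simp add: abs_mult)
    then show ?thesis using n2 by simp
  qed
  have "inner f f \<le> (\<Sum>w<n. K\<^sup>2)"
    unfolding ip_def power2_eq_square[symmetric]
    using f_le by (intro sum_mono) (simp add: abs_le_square_iff[symmetric] \<open>K \<ge> 0\<close>)
  then have norm_f: "inner f f \<le> real n * K\<^sup>2" by simp
  have lam: "0 \<le> lam A" "lam A < 1"
    using lam_less_1[OF conn n2] by (simp_all add: lam_def)
  have bound: "lam A ^ (2 * t) * inner f f \<le> 1"
  proof (cases "K = 0")
    \<comment> \<open>For equal initial loads f vanishes on the vertices; the logarithm of 0 would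
      give no information on t.\<close>
    case True
    then show ?thesis using norm_f ip_self_nonneg[of n f] by simp
  next
    case False
    then have Kn: "K * n > 0" using \<open>K \<ge> 0\<close> n2 by simp
    \<comment> \<open>The inequality 1 + z \<le> exp z at z = \<open>lam A - 1\<close> turns the
      spectral gap into exponential decay.\<close>
    have "lam A ^ t \<le> exp (lam A - 1) ^ t"
      using lam exp_ge_add_one_self[of "lam A - 1"] by (intro power_mono) auto
    also have "\<dots> = exp (- (real t * (1 - lam A)))"
      by (simp add: exp_of_nat_mult[symmetric] algebra_simps)
    also have "\<dots> \<le> exp (- ln (K * n))"
      using t lam by (simp add: K_def pos_divide_le_eq)
    also have "\<dots> = 1 / (K * n)" using Kn by (simp add: exp_minus inverse_eq_divide)
    finally have "(lam A ^ t)\<^sup>2 \<le> (1 / (K * n))\<^sup>2" using lam by (intro power_mono) auto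
    then have "lam A ^ (2 * t) * inner f f \<le> (1 / (K * n))\<^sup>2 * (real n * K\<^sup>2)"
      using norm_f ip_self_nonneg[of n f] by (intro mult_mono) (auto simp: power_mult[symmetric] mult.commute)
    also have "\<dots> = 1 / n" using \<open>K \<noteq> 0\<close> n2 by (simp add: field_simps power2_eq_square)
    also have "\<dots> \<le> 1" using n2 by simp
    finally show ?thesis .
  qed
  have close: "\<bar>xi \<gamma> n E x t w - avg\<bar> \<le> 1" if w: "w < n" for w
  proof -
    have "xi \<gamma> n E x t w = (P ^^ t) (\<lambda>u. f u + avg) w"
      by (simp add: xi_eq f_def)
    also have "\<dots> = (P ^^ t) f w + avg"
      using eigfun_pow[OF eigfun_const w, of t avg] by (simp add: P_pow_add)
    finally have "xi \<gamma> n E x t w - avg = (P ^^ t) f w" by simp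
    moreover have "((P ^^ t) f w)\<^sup>2 \<le> 1"
      using square_le_ip_self[OF w, of "(P ^^ t) f"] norm_P_pow_le[OF conn n2 mean0, of t] bound by linarith
    ultimately show ?thesis by (simp add: abs_square_le_1)
  qed
  show ?thesis using close[OF uv(1)] close[OF uv(2)] by linarith
qed

text \<open>R is any upper bound for the deviation radius, so each protocol can supply its own
  closed form. Two loads are each within R of continuous values that differ by at most 2, whence 2R
  + 2.\<close>

lemma protocol_bounds:
  assumes K: "subgaussian_step K c" "c > 0" and conn: "connected_on n E" and n2: "n \<ge> 2"
    and R: "4 * sqrt (c / (\<kappa> * (1 - 1 / \<gamma>)) * ln (real n)) \<le> R"
  shows protocol_deviation: "measure_pmf.prob (iter_kernel K x t)
      {y. \<forall>w<n. \<bar>real_of_int (y w) - xi \<gamma> n E x t w\<bar> \<le> R} \<ge> 1 - 2 / real n"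
    and protocol_discrepancy: "real t \<ge> ln (real_of_int (discK n x) * real n) / (1 - lam A) \<Longrightarrow>
      measure_pmf.prob (iter_kernel K x t)
        {y. \<forall>u<n. \<forall>v<n. real_of_int \<bar>y u - y v\<bar> \<le> 2 * R + 2} \<ge> 1 - 1 / real n"
proof -
  let ?G = "{y. \<forall>w<n. \<bar>real_of_int (y w) - xi \<gamma> n E x t w\<bar> \<le> R}"
  have "1 - 1 / real n \<le> measure_pmf.prob (iter_kernel K x t) {y. \<forall>w<n. \<bar>real_of_int (y w) - xi \<gamma> n E x t w\<bar>
      \<le> 4 * sqrt (c / (\<kappa> * (1 - 1 / \<gamma>)) * ln (real n))}"
    by (rule iter_kernel_deviation[OF K n2])
  also have "\<dots> \<le> measure_pmf.prob (iter_kernel K x t) ?G"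
    using R by (intro measure_pmf.finite_measure_mono) (auto intro: order.trans)
  finally have G: "1 - 1 / real n \<le> measure_pmf.prob (iter_kernel K x t) ?G" .
  moreover have "1 / real n \<le> 2 / real n" using n2 by (simp add: field_simps)
  ultimately show "1 - 2 / real n \<le> measure_pmf.prob (iter_kernel K x t) ?G" by linarith
  assume t: "real t \<ge> ln (real_of_int (discK n x) * real n) / (1 - lam A)"
  have "?G \<subseteq> {y. \<forall>u<n. \<forall>v<n. real_of_int \<bar>y u - y v\<bar> \<le> 2 * R + 2}"
  proof (intro subsetI CollectI allI impI)
    fix y u v assume y: "y \<in> ?G" and uv: "u < n" "v < n"
    have "\<bar>load y u - xi \<gamma> n E x t u\<bar> \<le> R" "\<bar>load y v - xi \<gamma> n E x t v\<bar> \<le> R"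
      using y uv by auto
    then have "\<bar>load y u - load y v\<bar> \<le> 2 * R + 2"
      using xi_discrepancy_le[OF conn n2 t uv] by linarith
    then show "real_of_int \<bar>y u - y v\<bar> \<le> 2 * R + 2" by simp
  qed
  then have "measure_pmf.prob (iter_kernel K x t) ?G \<le>
      measure_pmf.prob (iter_kernel K x t) {y. \<forall>u<n. \<forall>v<n. real_of_int \<bar>y u - y v\<bar> \<le> 2 * R + 2}"
    by (intro measure_pmf.finite_measure_mono) auto
  with G show "1 - 1 / real n \<le> measure_pmf.prob (iter_kernel K x t)
      {y. \<forall>u<n. \<forall>v<n. real_of_int \<bar>y u - y v\<bar> \<le> 2 * R + 2}" by linarith
qed

section \<open>Explicit deviation radii\<close>

lemma edge_radius:
  "4 * sqrt (1 / 16 / (\<kappa> * (1 - 1 / \<gamma>)) * ln (real n)) \<le>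
     \<gamma> / sqrt (\<gamma> - 1) * sqrt (real (maxdeg n E) * ln (real n))"
proof -
  \<comment> \<open>Here \<open>\<kappa> * (1 - 1 / \<gamma>)\<close> is (\<gamma> - 1) divided by
    \<gamma>\<gamma> times the maximum degree; the 4 under \<gamma> cancels the leading 4 of the
    radius.\<close>
  have "1 / 16 / (\<kappa> * (1 - 1 / \<gamma>)) = (\<gamma> / 4)\<^sup>2 / (\<gamma> - 1) * real (maxdeg n E)"
    using gamma_gt_1 maxdeg_pos by (simp add: \<kappa>_def field_simps power2_eq_square)
  then have "sqrt (1 / 16 / (\<kappa> * (1 - 1 / \<gamma>)) * ln (real n)) =
      \<gamma> / 4 / sqrt (\<gamma> - 1) * sqrt (real (maxdeg n E) * ln (real n))"
    using gamma_gt_1 by (simp add: real_sqrt_mult real_sqrt_divide mult.assoc)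
  then show ?thesis by simp
qed

text \<open>Serves to absorb the additive 2 of the discrepancy bound into a multiple of the
  radius.\<close>

lemma sqrt_ln2_le: "n \<ge> 2 \<Longrightarrow> 2 \<le> 2 / sqrt (ln 2) * sqrt (ln (real n))"
proof -
  assume "n \<ge> 2"
  then have "sqrt (ln 2) \<le> sqrt (ln (real n))" by simp
  moreover have "sqrt (ln 2 :: real) > 0" by simp
  ultimately show ?thesis by (simp add: field_simps)
qed

end

text \<open>For this \<gamma> the product \<open>\<kappa> * (1 - 1 / \<gamma>)\<close> is
  1/((d+1)(d+1)), so the variance factor is of order \<open>d ^ 3\<close>, which is bounded by
  \<open>d ^ 4\<close> to reach the stated form.\<close>

lemma vertex_radius:
  assumes "diffusion (1 + 1 / real d) n E" "regular_on n E d" "d \<ge> 1"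
  shows "4 * sqrt (real d / 8 / (diffusion.\<kappa> (1 + 1 / real d) n E * (1 - 1 / (1 + 1 / real d))) * ln (real n))
    \<le> 4 * real d ^ 2 * sqrt (ln (real n))"
proof -
  interpret diffusion "1 + 1 / real d" n E by fact
  have "1 - 1 / (1 + 1 / real d) = 1 / (real d + 1)"
    using assms(3) by (simp add: field_simps)
  then have "\<kappa> * (1 - 1 / (1 + 1 / real d)) = 1 / (real d + 1)\<^sup>2"
    using kappa_regular[OF assms(2,3) refl] by (simp add: power2_eq_square)
  then have "real d / 8 / (\<kappa> * (1 - 1 / (1 + 1 / real d))) = real d / 8 * (real d + 1)\<^sup>2"
    by simp
  also have "\<dots> \<le> real d / 8 * (2 * real d)\<^sup>2"
    using assms(3) by (intro mult_left_mono power_mono) auto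
  also have "\<dots> = real d ^ 3 / 2" by (simp add: power2_eq_square power3_eq_cube)
  also have "\<dots> \<le> real d ^ 4"
  proof -
    have "real d ^ 3 \<le> real d ^ 4" using assms(3) by (intro power_increasing) auto
    then show ?thesis using zero_le_power[of "real d" 3] by linarith
  qed
  finally have "real d / 8 / (\<kappa> * (1 - 1 / (1 + 1 / real d))) * ln (real n) \<le> (real d ^ 2)\<^sup>2 * ln (real n)"
    using n_pos by (intro mult_right_mono) auto
  then have "sqrt (real d / 8 / (\<kappa> * (1 - 1 / (1 + 1 / real d))) * ln (real n)) \<le>
      sqrt ((real d ^ 2)\<^sup>2 * ln (real n))"
    by (rule real_sqrt_le_mono)
  also have "\<dots> = real d ^ 2 * sqrt (ln (real n))"
    by (simp only: real_sqrt_mult real_sqrt_abs abs_power2)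
  finally show ?thesis by linarith
qed

section \<open>Choice of the constants and the one-vertex case\<close>

theorem theorem5p5:
  shows
  \<comment> \<open>(a) edge-based protocol, first claim\<close>
  "(\<forall>\<gamma>>1. \<exists>C. \<forall>n E x0 t.
      graph_on n E \<and> connected_on n E \<longrightarrow>
      measure_pmf.prob (edge_proc \<gamma> n E x0 t)
        {x. \<forall>w<n. \<bar>real_of_int (x w) - xi \<gamma> n E x0 t w\<bar>
                  \<le> C * sqrt (real (maxdeg n E) * ln (real n))}
      \<ge> 1 - 2 / real n)
   \<and>
  \<comment> \<open>(a) edge-based protocol, second claim\<close>
   (\<forall>\<gamma>>1. \<exists>C1 C2. \<forall>n E x0 t.
      graph_on n E \<and> connected_on n E \<and>
      real t \<ge> C1 * ln (real_of_int (discK n x0) * real n) / (1 - lam (Pmat \<gamma> n E)) \<longrightarrow>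
      measure_pmf.prob (edge_proc \<gamma> n E x0 t)
        {x. \<forall>u<n. \<forall>v<n. real_of_int \<bar>x u - x v\<bar>
                  \<le> C2 * sqrt (real (maxdeg n E) * ln (real n))}
      \<ge> 1 - 1 / real n)
   \<and>
  \<comment> \<open>(b) vertex-based protocol, first claim\<close>
   (\<exists>C. \<forall>n E d x0 t.
      graph_on n E \<and> connected_on n E \<and> regular_on n E d \<longrightarrow>
      measure_pmf.prob (vertex_proc n E d x0 t)
        {x. \<forall>w<n. \<bar>real_of_int (x w) - xi (1 + 1 / real d) n E x0 t w\<bar>
                  \<le> C * real d ^ 2 * sqrt (ln (real n))}
      \<ge> 1 - 2 / real n)
   \<and>
  \<comment> \<open>(b) vertex-based protocol, second claim\<close>
   (\<exists>C1 C2. \<forall>n E d x0 t.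
      graph_on n E \<and> connected_on n E \<and> regular_on n E d \<and>
      real t \<ge> C1 * ln (real_of_int (discK n x0) * real n)
                   / (1 - lam (Pmat (1 + 1 / real d) n E)) \<longrightarrow>
      measure_pmf.prob (vertex_proc n E d x0 t)
        {x. \<forall>u<n. \<forall>v<n. real_of_int \<bar>x u - x v\<bar>
                  \<le> C2 * real d ^ 2 * sqrt (ln (real n))}
      \<ge> 1 - 1 / real n)"
proof (intro conjI allI impI)
  \<comment> \<open>A single vertex makes both lower bounds on the probability nonpositive.\<close>
  have trivial: "1 - 2 / real n \<le> measure_pmf.prob p S \<and> 1 - 1 / real n \<le> measure_pmf.prob p S"
    if "graph_on n E" "\<not> n \<ge> 2" for n E and p :: "(nat \<Rightarrow> int) pmf" and S
  proof -
    have "n = 1" using that by (auto simp: graph_on_def)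
    then have "1 - 2 / real n \<le> 0" "1 - 1 / real n \<le> 0" by simp_all
    then show ?thesis using measure_nonneg[of "measure_pmf p" S] by linarith
  qed
  {
    fix \<gamma> :: real assume \<gamma>: "\<gamma> > 1"
    have "1 - 2 / real n \<le> measure_pmf.prob (edge_proc \<gamma> n E x0 t)
        {x. \<forall>w<n. \<bar>real_of_int (x w) - xi \<gamma> n E x0 t w\<bar>
          \<le> \<gamma> / sqrt (\<gamma> - 1) * sqrt (real (maxdeg n E) * ln (real n))}"
      if g: "graph_on n E \<and> connected_on n E" for n E x0 t
    proof (cases "n \<ge> 2")
      case True
      interpret diffusion \<gamma> n E using g True \<gamma> by (intro diffusionI) auto
      show ?thesis unfolding edge_proc_eq
        using g True by (intro protocol_deviation[OF edge_step_subgaussian] edge_radius) auto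
    qed (use trivial g in blast)
    then show "\<exists>C. \<forall>n E x0 t. graph_on n E \<and> connected_on n E \<longrightarrow>
      measure_pmf.prob (edge_proc \<gamma> n E x0 t)
        {x. \<forall>w<n. \<bar>real_of_int (x w) - xi \<gamma> n E x0 t w\<bar>
                  \<le> C * sqrt (real (maxdeg n E) * ln (real n))}
      \<ge> 1 - 2 / real n" by blast
  next
    fix \<gamma> :: real assume \<gamma>: "\<gamma> > 1"
    \<comment> \<open>Two deviations of radius \<gamma> / sqrt(\<gamma> - 1), plus the share that
      absorbs the additive 2. The time constant is 1.\<close>
    let ?C = "2 * (\<gamma> / sqrt (\<gamma> - 1)) + 2 / sqrt (ln 2)"
    have "1 - 1 / real n \<le> measure_pmf.prob (edge_proc \<gamma> n E x0 t)
        {x. \<forall>u<n. \<forall>v<n. real_of_int \<bar>x u - x v\<bar> \<le> ?C * sqrt (real (maxdeg n E) * ln (real n))}"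
      if g: "graph_on n E \<and> connected_on n E \<and>
        real t \<ge> 1 * ln (real_of_int (discK n x0) * real n) / (1 - lam (Pmat \<gamma> n E))" for n E x0 t
    proof (cases "n \<ge> 2")
      case True
      interpret diffusion \<gamma> n E using g True \<gamma> by (intro diffusionI) auto
      let ?R = "\<gamma> / sqrt (\<gamma> - 1) * sqrt (real (maxdeg n E) * ln (real n))"
      have "sqrt (ln (real n)) \<le> sqrt (real (maxdeg n E) * ln (real n))"
        using maxdeg_pos True mult_right_mono[of 1 "real (maxdeg n E)" "ln (real n)"] by simp
      then have "2 / sqrt (ln 2) * sqrt (ln (real n)) \<le> 2 / sqrt (ln 2) * sqrt (real (maxdeg n E) * ln (real n))"
        by (intro mult_left_mono) auto
      then have le: "2 * ?R + 2 \<le> ?C * sqrt (real (maxdeg n E) * ln (real n))"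
        using sqrt_ln2_le[OF True] by (simp only: distrib_right mult.assoc)
      have "1 - 1 / real n \<le> measure_pmf.prob (edge_proc \<gamma> n E x0 t)
        {x. \<forall>u<n. \<forall>v<n. real_of_int \<bar>x u - x v\<bar> \<le> 2 * ?R + 2}"
        unfolding edge_proc_eq
        using g True by (intro protocol_discrepancy[OF edge_step_subgaussian] edge_radius) auto
      also have "\<dots> \<le> measure_pmf.prob (edge_proc \<gamma> n E x0 t)
        {x. \<forall>u<n. \<forall>v<n. real_of_int \<bar>x u - x v\<bar> \<le> ?C * sqrt (real (maxdeg n E) * ln (real n))}"
        using order.trans[OF _ le] by (intro measure_pmf.finite_measure_mono) auto
      finally show ?thesis .
    qed (use trivial g in blast)
    then show "\<exists>C1 C2. \<forall>n E x0 t.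
      graph_on n E \<and> connected_on n E \<and>
      real t \<ge> C1 * ln (real_of_int (discK n x0) * real n) / (1 - lam (Pmat \<gamma> n E)) \<longrightarrow>
      measure_pmf.prob (edge_proc \<gamma> n E x0 t)
        {x. \<forall>u<n. \<forall>v<n. real_of_int \<bar>x u - x v\<bar>
                  \<le> C2 * sqrt (real (maxdeg n E) * ln (real n))}
      \<ge> 1 - 1 / real n" by blast
  }
  have regular: "diffusion (1 + 1 / real d) n E" "d \<ge> 1"
    if "graph_on n E \<and> connected_on n E \<and> regular_on n E d" "n \<ge> 2" for n E d
  proof -
    \<comment> \<open>The auxiliary parameter 2 yields a positive maximum degree and hence
      \<open>d \<ge> 1\<close>. Only then is \<open>1 + 1 / real d\<close> known to exceed 1,
      because \<open>1 / real 0\<close> is 0.\<close>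
    have "diffusion 2 n E" using that by (intro diffusionI) auto
    then have "maxdeg n E \<ge> 1" by (simp add: diffusion_def)
    then show "d \<ge> 1" using regular_maxdeg[of n E d] that by simp
    then show "diffusion (1 + 1 / real d) n E" using that by (intro diffusionI) auto
  qed
  have "1 - 2 / real n \<le> measure_pmf.prob (vertex_proc n E d x0 t)
      {x. \<forall>w<n. \<bar>real_of_int (x w) - xi (1 + 1 / real d) n E x0 t w\<bar> \<le> 4 * real d ^ 2 * sqrt (ln (real n))}"
    if g: "graph_on n E \<and> connected_on n E \<and> regular_on n E d" for n E d x0 t
  proof (cases "n \<ge> 2")
    case True
    note d = regular[OF g True]
    interpret diffusion "1 + 1 / real d" n E by (rule d(1))
    show ?thesis unfolding vertex_proc_eq
      using g True d by (intro protocol_deviation[OF vertex_step_subgaussian] vertex_radius) auto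
  qed (use trivial g in blast)
  then show "\<exists>C. \<forall>n E d x0 t.
      graph_on n E \<and> connected_on n E \<and> regular_on n E d \<longrightarrow>
      measure_pmf.prob (vertex_proc n E d x0 t)
        {x. \<forall>w<n. \<bar>real_of_int (x w) - xi (1 + 1 / real d) n E x0 t w\<bar>
                  \<le> C * real d ^ 2 * sqrt (ln (real n))}
      \<ge> 1 - 2 / real n" by blast
  \<comment> \<open>Twice the deviation constant 4, plus the share that absorbs the additive 2;
    again the time constant is 1.\<close>
  let ?C = "8 + 2 / sqrt (ln 2) :: real"
  have "1 - 1 / real n \<le> measure_pmf.prob (vertex_proc n E d x0 t)
      {x. \<forall>u<n. \<forall>v<n. real_of_int \<bar>x u - x v\<bar> \<le> ?C * real d ^ 2 * sqrt (ln (real n))}"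
    if g: "graph_on n E \<and> connected_on n E \<and> regular_on n E d \<and>
        real t \<ge> 1 * ln (real_of_int (discK n x0) * real n)
                   / (1 - lam (Pmat (1 + 1 / real d) n E))" for n E d x0 t
  proof (cases "n \<ge> 2")
    case True
    have d: "diffusion (1 + 1 / real d) n E" "d \<ge> 1" using regular g True by blast+
    interpret diffusion "1 + 1 / real d" n E by (rule d(1))
    let ?R = "4 * real d ^ 2 * sqrt (ln (real n))"
    have "1 * sqrt (ln (real n)) \<le> real d ^ 2 * sqrt (ln (real n))"
      using d(2) True by (intro mult_right_mono) auto
    then have "2 / sqrt (ln 2) * sqrt (ln (real n)) \<le> 2 / sqrt (ln 2) * (real d ^ 2 * sqrt (ln (real n)))"
      by (intro mult_left_mono) auto
    then have le: "2 * ?R + 2 \<le> ?C * real d ^ 2 * sqrt (ln (real n))"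
      using sqrt_ln2_le[OF True] by (simp only: distrib_right mult.assoc)
    have "1 - 1 / real n \<le> measure_pmf.prob (vertex_proc n E d x0 t)
        {x. \<forall>u<n. \<forall>v<n. real_of_int \<bar>x u - x v\<bar> \<le> 2 * ?R + 2}"
      unfolding vertex_proc_eq
      using g True d by (intro protocol_discrepancy[OF vertex_step_subgaussian] vertex_radius) auto
    also have "\<dots> \<le> measure_pmf.prob (vertex_proc n E d x0 t)
        {x. \<forall>u<n. \<forall>v<n. real_of_int \<bar>x u - x v\<bar> \<le> ?C * real d ^ 2 * sqrt (ln (real n))}"
      using order.trans[OF _ le] by (intro measure_pmf.finite_measure_mono) auto
    finally show ?thesis .
  qed (use trivial g in blast)
  then show "\<exists>C1 C2. \<forall>n E d x0 t.
      graph_on n E \<and> connected_on n E \<and> regular_on n E d \<and>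
      real t \<ge> C1 * ln (real_of_int (discK n x0) * real n)
                   / (1 - lam (Pmat (1 + 1 / real d) n E)) \<longrightarrow>
      measure_pmf.prob (vertex_proc n E d x0 t)
        {x. \<forall>u<n. \<forall>v<n. real_of_int \<bar>x u - x v\<bar>
                  \<le> C2 * real d ^ 2 * sqrt (ln (real n))}
      \<ge> 1 - 1 / real n" by blast
qed

end
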